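(* Let $\mathbf e_0\in\mathcal B_*$. Let $M$ be the matrix of the effective form at the beginning of the spectrum of the discrete normalized Laplacian $\Delta$ on the $\mathbb Z^d$-periodic graph $\Gamma$, i.e. $\mu(\omega)=\langle M\omega,\omega\rangle$, and let $m_1\ge m_2\ge\dots\ge m_d$ be the eigenvalues of the effective mass tensor $m=M^{-1}$. Then $$C_0\le\operatorname{Tr}M\le C_1,\qquad \frac{\varkappa\,\nu\,d}{\Lambda_0}\ge m_1\ge\dots\ge m_d\ge\frac1{C_1},$$ where $$C_0=\frac1{\varkappa\,\nu}\|\tau(\mathbf e_0)\|^2,\qquad C_1=\frac1\varkappa\sum_{\mathbf e\in\mathcal B_*}\|\tau(\mathbf e)\|^2,\qquad \varkappa=\sum_{v\in V_*}\varkappa_v .$$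
   Context: Graph. Let $d\ge2$ and let $\Gamma=(V,\mathcal E)$ be a connected infinite graph, possibly with loops and multiple edges, with vertex set $V$ and set $\mathcal E$ of unoriented edges. The degree $\varkappa_v$ of a vertex is the number of edges incident to it, a loop being counted twice. $\Gamma$ is $\mathbb Z^d$-periodic: it is equipped with an action of $\mathbb Z^d$ by graph automorphisms, written $v\mapsto v+m$, free on vertices; all degrees are finite; and the quotient (fundamental) graph $\Gamma_*=\Gamma/\mathbb Z^d=(V_*,\mathcal E_* )$ is finite. Put $\nu=\#V_*$. The degree of a vertex of $\Gamma_*$ equals that of any of its representatives in $V$. Oriented edges and indices. Each unoriented edge with endpoints $u,v$ yields two oriented edges $(u,v)$ and $(v,u)$ (also for loops); $\mathcal A$ and $\mathcal A_*$ denote the sets of oriented edges of $\Gamma$ and $\Gamma_*$. A fundamental vertex set $V_0\subset V$ is a set of $\nu$ pairwise non-$\mathbb Z^d$-equivalent vertices. Each $v\in V$ is uniquely $v=v_0+[v]$ with $v_0\in V_0$, $[v]\in\mathbb Z^d$. The index of $\mathbf e=(u,v)\in\mathcal A$ is $\tau(\mathbf e)=[v]-[u]\in\mathbb Z^d$; it is $\mathbb Z^d$-invariant, so it defines the index $\tau(\mathbf e_* )$ of each $\mathbf e_*\in\mathcal A_*$. Choice of $V_0$. $V_0$ is the vertex set $V_T$ of a subgraph $T=(V_T,\mathcal E_T)$ of $\Gamma$ that is a tree and whose vertex set is a fundamental vertex set (such $T$ exists). Then $T_*=T/\mathbb Z^d$ is a spanning tree of $\Gamma_*$ all of whose edges have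 zero index. Bridges. Orient each edge of $\mathcal E_*$ in an arbitrary way; indices of edges of $\mathcal E_*$ refer to this orientation. $\mathcal B_*\subset\mathcal E_*$ is the set of bridges, i.e. edges with nonzero index. Since $\Gamma$ is connected, there exist bridges $\mathbf e_1,\dots,\mathbf e_d\in\mathcal B_*$ with linearly independent indices; fix such bridges. Let $\mathcal T_0$ be the $d\times d$ matrix with rows $\tau(\mathbf e_1),\dots,\tau(\mathbf e_d)$, and let $\Lambda_0>0$ be the smallest eigenvalue of $\mathcal T_0^*\mathcal T_0$. Laplacian. On $\ell^2(V)$, $(\Delta f)(v)=\frac1{\sqrt{\varkappa_v}}\sum_{(v,u)_e\in\mathcal E}\Big(\frac{f(v)}{\sqrt{\varkappa_v}}-\frac{f(u)}{\sqrt{\varkappa_u}}\Big)$, loops counted twice. It decomposes into a direct integral over $\mathbb T^d=\mathbb R^d/(2\pi\mathbb Z)^d$ with fibers the $\nu\times\nu$ Hermitian Floquet matrices $\Delta(\vartheta)$, $$\Delta_{uv}(\vartheta)=\delta_{uv}-\frac1{\sqrt{\varkappa_u\varkappa_v}}\sum_{\mathbf e=(u,v)\in\mathcal A_*}e^{i\langle\tau(\mathbf e),\vartheta\rangle},\qquad u,v\in V_*$$ (empty sum $=0$). $\lambda_1(\vartheta)$ denotes the lowest eigenvalue (first band function) of $\Delta(\vartheta)$ near $\vartheta=0$. The beginning of the spectrum of $\Delta$ is $\lambda_1(0)=0$, which is a simple eigenvalue of $\Delta(0)$, and the effective form $\mu$ there is the quadratic form defined by $\lambda_1(\varepsilon\omega)=\varepsilon^2\mu(\omega)+O(\varepsilon^3)$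 as $\varepsilon\to0^+$, $\omega\in\mathbb S^{d-1}$ (the unit sphere of $\mathbb R^d$). The matrix $M\ge0$ is the real symmetric $d\times d$ matrix with $\mu(\omega)=\langle M\omega,\omega\rangle$. $\|\cdot\|$, $\langle\cdot,\cdot\rangle$ are the Euclidean norm and inner product on $\mathbb R^d$. *)

theory Defs
  imports
    "HOL-Analysis.Analysis"
    "HOL-Library.Landau_Symbols"
    "Graph_Theory.Bidirected_Digraph"
    "Graph_Theory.Arc_Walk"
    "Graph_Theory.Digraph_Component"
begin

text \<open>
  A graph with loops and multiple edges is a \<^locale>\<open>bidirected_digraph\<close>: its arcs are
  the oriented edges, the fixed-point free involution \<open>arev\<close> reverses the orientation, and the
  unoriented edges are the pairs \<open>{a, arev a}\<close>. A loop contributes two arcs as well, so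
  \<^const>\<open>out_degree\<close> counts a loop twice and is the degree of a vertex.

  The group of integer vectors acts by \<open>vact\<close> on vertices and by \<open>aact\<close> on arcs.
  An automorphism acts on the unoriented edges precisely if it commutes with \<open>arev\<close>.
\<close>

definition orbit :: "(int^'d \<Rightarrow> 'x \<Rightarrow> 'x) \<Rightarrow> 'x \<Rightarrow> 'x set" where
  "orbit act x = range (\<lambda>m. act m x)"

text \<open>
  The arcs of the quotient are orbits of arcs. By equivariance the tails of the arcs in an orbit form
  a vertex orbit, so the image under \<^const>\<open>tail\<close> is the tail of the quotient arc; likewise for
  \<^const>\<open>head\<close>, and the reversal on the quotient is \<open>image arev\<close>.
\<close>

definition quotient_graph ::
  "('v,'a) pre_digraph \<Rightarrow> (int^'d \<Rightarrow> 'v \<Rightarrow> 'v) \<Rightarrow> (int^'d \<Rightarrow> 'a \<Rightarrow> 'a) \<Rightarrow> ('v set, 'a set) pre_digraph" where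
  "quotient_graph G vact aact =
     \<lparr> verts = orbit vact ` verts G, arcs = orbit aact ` arcs G,
       tail = image (tail G), head = image (head G) \<rparr>"

locale periodic_graph = bidirected_digraph G arev
  for G :: "('v,'a) pre_digraph" and arev :: "'a \<Rightarrow> 'a" +
  fixes vact :: "int^'d::finite \<Rightarrow> 'v \<Rightarrow> 'v" and aact :: "int^'d \<Rightarrow> 'a \<Rightarrow> 'a"
  assumes dim_ge_2: "CARD('d) \<ge> 2"
    and infinite_verts: "infinite (verts G)"
    and connected_graph: "Digraph_Component.connected G"
    and finite_degrees: "\<And>v. v \<in> verts G \<Longrightarrow> finite (out_arcs G v)"
    and vact_closed: "\<And>m v. v \<in> verts G \<Longrightarrow> vact m v \<in> verts G"
    and vact_zero: "\<And>v. v \<in> verts G \<Longrightarrow> vact 0 v = v"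
    and vact_add: "\<And>m n v. v \<in> verts G \<Longrightarrow> vact (m + n) v = vact m (vact n v)"
    and vact_free: "\<And>m v. v \<in> verts G \<Longrightarrow> vact m v = v \<Longrightarrow> m = 0"
    and aact_closed: "\<And>m a. a \<in> arcs G \<Longrightarrow> aact m a \<in> arcs G"
    and aact_zero: "\<And>a. a \<in> arcs G \<Longrightarrow> aact 0 a = a"
    and aact_add: "\<And>m n a. a \<in> arcs G \<Longrightarrow> aact (m + n) a = aact m (aact n a)"
    and tail_aact: "\<And>m a. a \<in> arcs G \<Longrightarrow> tail G (aact m a) = vact m (tail G a)"
    and head_aact: "\<And>m a. a \<in> arcs G \<Longrightarrow> head G (aact m a) = vact m (head G a)"
    and arev_aact: "\<And>m a. a \<in> arcs G \<Longrightarrow> arev (aact m a) = aact m (arev a)"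
    and finite_quotient_verts: "finite (verts (quotient_graph G vact aact))"
    and finite_quotient_arcs: "finite (arcs (quotient_graph G vact aact))"

definition fundamental_vertex_set ::
  "('v,'a) pre_digraph \<Rightarrow> (int^'d \<Rightarrow> 'v \<Rightarrow> 'v) \<Rightarrow> 'v set \<Rightarrow> bool" where
  "fundamental_vertex_set G vact V0 \<longleftrightarrow>
     V0 \<subseteq> verts G \<and> card V0 = card (orbit vact ` verts G) \<and>
     (\<forall>u\<in>V0. \<forall>v\<in>V0. \<forall>m. v = vact m u \<longrightarrow> u = v)"

text \<open>
  A subgraph contains with each arc its reversal. A directed closed path is a cycle of the underlying
  unoriented graph iff it does not traverse an edge in both directions (this only excludes the
  back-and-forth walks \<open>[a, arev a]\<close>).
\<close>

definition is_subtree ::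
  "('v,'a) pre_digraph \<Rightarrow> ('v,'a) pre_digraph \<Rightarrow> ('a \<Rightarrow> 'a) \<Rightarrow> bool" where
  "is_subtree T G arev \<longleftrightarrow>
     subgraph T G \<and> arev ` arcs T \<subseteq> arcs T \<and> Digraph_Component.connected T \<and>
     \<not> (\<exists>p. pre_digraph.cycle T p \<and> (\<forall>a\<in>set p. arev a \<notin> set p))"

text \<open>The vector \<open>[v]\<close> with \<open>v = v\<^sub>0 + [v]\<close>, \<open>v\<^sub>0 \<in> V\<^sub>0\<close>.\<close>

definition int_part :: "(int^'d \<Rightarrow> 'v \<Rightarrow> 'v) \<Rightarrow> 'v set \<Rightarrow> 'v \<Rightarrow> int^'d" where
  "int_part vact V0 v = (THE m. \<exists>v0\<in>V0. v = vact m v0)"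

definition arc_index ::
  "('v,'a) pre_digraph \<Rightarrow> (int^'d \<Rightarrow> 'v \<Rightarrow> 'v) \<Rightarrow> 'v set \<Rightarrow> 'a \<Rightarrow> int^'d" where
  "arc_index G vact V0 a = int_part vact V0 (head G a) - int_part vact V0 (tail G a)"

definition real_vec :: "int^'d \<Rightarrow> real^'d" where
  "real_vec t = (\<chi> i. real_of_int (t $ i))"

text \<open>The common index of the arcs in an orbit, as a real vector.\<close>

definition quotient_index ::
  "('v,'a) pre_digraph \<Rightarrow> (int^'d \<Rightarrow> 'v \<Rightarrow> 'v) \<Rightarrow> 'v set \<Rightarrow> 'a set \<Rightarrow> real^'d" where
  "quotient_index G vact V0 A = real_vec (the_elem (arc_index G vact V0 ` A))"

text \<open>A choice of one arc from each unoriented edge.\<close>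

definition edge_orientation :: "('v,'a) pre_digraph \<Rightarrow> ('a \<Rightarrow> 'a) \<Rightarrow> 'a set \<Rightarrow> bool" where
  "edge_orientation Q flip E \<longleftrightarrow>
     E \<subseteq> arcs Q \<and> (\<forall>a\<in>arcs Q. a \<in> E \<longleftrightarrow> flip a \<notin> E)"

definition bridges :: "('a \<Rightarrow> real^'d) \<Rightarrow> 'a set \<Rightarrow> 'a set" where
  "bridges \<tau> E = {e \<in> E. \<tau> e \<noteq> 0}"

text \<open>
  The fiber at the quasimomentum \<open>\<theta>\<close> of the normalized Laplacian
  \<open>(\<Delta> f)(v) = \<kappa>\<^sub>v\<^sup>-\<^sup>1\<^sup>/\<^sup>2 \<Sum> (\<kappa>\<^sub>v\<^sup>-\<^sup>1\<^sup>/\<^sup>2 f(v) - \<kappa>\<^sub>u\<^sup>-\<^sup>1\<^sup>/\<^sup>2 f(u))\<close>, the sum over the arcs from \<open>v\<close> to \<open>u\<close>.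
  Its rows and columns are indexed by the vertices of the quotient graph \<open>Q\<close>, whose arcs have
  indices \<open>\<tau>\<close>.
\<close>

definition floquet_matrix ::
  "('v,'a) pre_digraph \<Rightarrow> ('a \<Rightarrow> real^'d) \<Rightarrow> real^'d \<Rightarrow> 'v \<Rightarrow> 'v \<Rightarrow> complex" where
  "floquet_matrix Q \<tau> \<theta> u v =
     (if u = v then 1 else 0) -
     1 / of_real (sqrt (real (out_degree Q u) * real (out_degree Q v))) *
     (\<Sum>e\<in>{e \<in> arcs Q. tail Q e = u \<and> head Q e = v}. exp (\<i> * of_real (\<tau> e \<bullet> \<theta>)))"

text \<open>Eigenvalues of a square matrix whose rows and columns are indexed by a finite set \<open>I\<close>.\<close>

definition eigenvalue_on :: "'i set \<Rightarrow> ('i \<Rightarrow> 'i \<Rightarrow> 'k::field) \<Rightarrow> 'k \<Rightarrow> bool" where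
  "eigenvalue_on I K l \<longleftrightarrow>
     (\<exists>f. (\<exists>u\<in>I. f u \<noteq> 0) \<and> (\<forall>u\<in>I. (\<Sum>v\<in>I. K u v * f v) = l * f u))"

definition first_band ::
  "('v,'a) pre_digraph \<Rightarrow> ('a \<Rightarrow> real^'d) \<Rightarrow> real^'d \<Rightarrow> real" where
  "first_band Q \<tau> \<theta> = Min {x. eigenvalue_on (verts Q) (floquet_matrix Q \<tau> \<theta>) (complex_of_real x)}"

text \<open>
  The expansion \<open>\<lambda>\<^sub>1(\<epsilon>\<omega>) = \<epsilon>\<^sup>2 \<mu>(\<omega>) + O(\<epsilon>\<^sup>3)\<close>, \<open>\<epsilon> \<rightarrow> 0+\<close>, at the beginning \<open>\<lambda>\<^sub>1(0) = 0\<close> of the spectrum.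
\<close>

definition effective_form :: "(real^'d \<Rightarrow> real) \<Rightarrow> (real^'d \<Rightarrow> real) \<Rightarrow> bool" where
  "effective_form band \<mu> \<longleftrightarrow>
     (\<forall>\<omega>. norm \<omega> = 1 \<longrightarrow>
        (\<lambda>\<epsilon>::real. band (\<epsilon> *\<^sub>R \<omega>) - \<epsilon>^2 * \<mu> \<omega>) \<in> O[at_right 0](\<lambda>\<epsilon>. \<epsilon>^3))"

definition smallest_eigenvalue :: "real^'d^'d \<Rightarrow> real" where
  "smallest_eigenvalue A = Min {l. eigenvalue_on UNIV (\<lambda>i j. A $ i $ j) l}"

text \<open>
  \<open>m 1 \<ge> \<dots> \<ge> m d\<close> are the eigenvalues of \<open>A\<close>, counted with multiplicity as the roots of the
  characteristic polynomial.
\<close>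

definition decreasing_eigenvalues :: "real^'d^'d \<Rightarrow> (nat \<Rightarrow> real) \<Rightarrow> bool" where
  "decreasing_eigenvalues A m \<longleftrightarrow>
     (\<forall>x. det (mat x - A) = (\<Prod>i=1..CARD('d). x - m i)) \<and>
     (\<forall>i\<in>{1..<CARD('d)}. m i \<ge> m (Suc i))"

end

theory Submission
  imports Defs
begin

text \<open>
  The lowest eigenvalue of the Floquet matrix at \<open>\<theta>\<close> is the minimum of the energy
  \<open>1/2 \<Sum>\<^sub>a \<bar>h(tail a) - exp(i \<langle>\<tau>(a),\<theta>\<rangle>) h(head a)\<bar>\<^sup>2\<close> over the vertex functions \<open>h\<close> with
  \<open>\<Sum>\<^sub>v \<kappa>\<^sub>v \<bar>h(v)\<bar>\<^sup>2 = 1\<close> (\<open>first_band_le\<close>, \<open>first_band_attained\<close>). Hence bounds on the energy are bounds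
  on the first band, and at \<open>\<theta> = \<epsilon>\<omega>\<close>, after division by \<open>\<epsilon>\<^sup>2\<close>, they become bounds on the effective form
  in the limit.

  From above, a constant \<open>h\<close> has energy at most \<open>1/2 \<Sum>\<^sub>a \<langle>\<tau>(a),\<theta>\<rangle>\<^sup>2\<close>, which yields
  \<open>\<kappa> \<mu>(\<omega>) \<le> \<Sum>\<^sub>b \<langle>\<tau>(b),\<omega>\<rangle>\<^sup>2\<close>, the sum over the bridges (\<open>effective_form_le\<close>).

  From below, a bridge \<open>b\<close> closes up, through edges of zero index, to a cycle with at most \<open>\<nu>\<close> edges.
  The total phase along this cycle is that of \<open>b\<close>, so its terms
  \<open>\<bar>h(tail a) - exp(i \<langle>\<tau>(a),\<theta>\<rangle>) h(head a)\<bar>\<close> add up to at least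
  \<open>\<bar>h(u)\<bar> \<bar>exp(i \<langle>\<tau>(b),\<theta>\<rangle>) - 1\<bar>\<close>, where \<open>u\<close> is the tail of \<open>b\<close>; by the Cauchy--Schwarz inequality the
  square of the sum is at most \<open>\<nu>\<close> times the energy (\<open>cycle_bound\<close>). The same estimate along paths
  of zero index shows that a minimizing \<open>h\<close> of small energy is nearly constant in modulus, with value
  close to \<open>\<kappa>\<^sup>-\<^sup>1\<^sup>/\<^sup>2\<close> (\<open>amplitude_ge\<close>). Together, \<open>\<langle>\<tau>(b),\<omega>\<rangle>\<^sup>2 \<le> \<kappa> \<nu> \<mu>(\<omega>)\<close>
  (\<open>effective_form_ge\<close>). The paths exist because every edge of the tree \<open>T\<close> has zero index
  (\<open>zero_index_quotient_connected\<close>).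

  The trace bounds are the sums of these two inequalities over the coordinate directions. For the masses,
  the sum of the lower bounds over the \<open>d\<close> independent bridges is
  \<open>\<langle>T\<^sub>0\<^sup>* T\<^sub>0 \<omega>, \<omega>\<rangle> \<le> \<kappa> \<nu> d \<mu>(\<omega>)\<close>, so \<open>\<Lambda>\<^sub>0 / (\<kappa> \<nu> d) \<le> M \<le> C\<^sub>1\<close> as quadratic forms, and the eigenvalues of
  the inverse of \<open>M\<close> lie between the reciprocals of these constants.
\<close>

section \<open>Hermitian matrices on a finite index set\<close>

definition cinner_on :: "'i set \<Rightarrow> ('i \<Rightarrow> complex) \<Rightarrow> ('i \<Rightarrow> complex) \<Rightarrow> complex" where
  "cinner_on I f g = (\<Sum>u\<in>I. cnj (f u) * g u)"

definition mat_app :: "'i set \<Rightarrow> ('i \<Rightarrow> 'i \<Rightarrow> complex) \<Rightarrow> ('i \<Rightarrow> complex) \<Rightarrow> 'i \<Rightarrow> complex" where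
  "mat_app I K f u = (\<Sum>v\<in>I. K u v * f v)"

definition hermitian_on :: "'i set \<Rightarrow> ('i \<Rightarrow> 'i \<Rightarrow> complex) \<Rightarrow> bool" where
  "hermitian_on I K \<longleftrightarrow> (\<forall>u\<in>I. \<forall>v\<in>I. K v u = cnj (K u v))"

lemma cinner_on_self: "cinner_on I f f = of_real (\<Sum>u\<in>I. (cmod (f u))\<^sup>2)"
  unfolding cinner_on_def of_real_sum complex_norm_square by (intro sum.cong refl mult.commute)

lemma cinner_on_commute: "cinner_on I g f = cnj (cinner_on I f g)"
  by (simp add: cinner_on_def mult.commute)

lemma cinner_on_add_right: "cinner_on I f (\<lambda>u. g u + h u) = cinner_on I f g + cinner_on I f h"
  by (simp add: cinner_on_def distrib_left sum.distrib)

lemma cinner_on_add_left: "cinner_on I (\<lambda>u. g u + h u) f = cinner_on I g f + cinner_on I h f"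
  by (simp add: cinner_on_def distrib_right sum.distrib)

lemma cinner_on_scale_right: "cinner_on I f (\<lambda>u. c * g u) = c * cinner_on I f g"
  by (simp add: cinner_on_def sum_distrib_left mult.left_commute)

lemma cinner_on_scale_left: "cinner_on I (\<lambda>u. c * g u) f = cnj c * cinner_on I g f"
  by (simp add: cinner_on_def sum_distrib_left mult.assoc)

lemma cinner_on_sum_right: "cinner_on I f (\<lambda>u. \<Sum>x\<in>X. c x * F x u) = (\<Sum>x\<in>X. c x * cinner_on I f (F x))"
  unfolding cinner_on_def sum_distrib_left by (subst sum.swap) (simp add: mult_ac)

lemma cinner_on_sum_left: "cinner_on I (\<lambda>u. \<Sum>x\<in>X. c x * F x u) f = (\<Sum>x\<in>X. cnj (c x) * cinner_on I (F x) f)"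
  by (subst cinner_on_commute, subst cinner_on_sum_right) (simp flip: cinner_on_commute)

lemmas cinner_on_linear = cinner_on_add_left cinner_on_add_right cinner_on_scale_left cinner_on_scale_right

lemma mat_app_add: "mat_app I K (\<lambda>u. f u + g u) = (\<lambda>u. mat_app I K f u + mat_app I K g u)"
  by (rule ext) (simp add: mat_app_def distrib_left sum.distrib)

lemma mat_app_scale: "mat_app I K (\<lambda>u. c * f u) = (\<lambda>u. c * mat_app I K f u)"
  by (rule ext) (simp add: mat_app_def sum_distrib_left mult.left_commute)

lemma cinner_on_hermitian:
  assumes "hermitian_on I K"
  shows "cinner_on I f (mat_app I K g) = cinner_on I (mat_app I K f) g"
proof -
  have "cinner_on I f (mat_app I K g) = (\<Sum>v\<in>I. \<Sum>u\<in>I. cnj (f u) * (K u v * g v))"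
    unfolding cinner_on_def mat_app_def by (subst sum.swap) (simp add: sum_distrib_left)
  also have "\<dots> = cinner_on I (mat_app I K f) g"
    unfolding cinner_on_def mat_app_def cnj_sum sum_distrib_right
  proof (intro sum.cong refl)
    fix u v assume "u \<in> I" "v \<in> I"
    then have "K u v = cnj (K v u)" using assms unfolding hermitian_on_def by blast
    then show "cnj (f u) * (K u v * g v) = cnj (K v u * f u) * g v" by (simp add: mult_ac)
  qed
  finally show ?thesis .
qed

lemma eigenvalue_on_mat_app:
  "eigenvalue_on I K l \<longleftrightarrow> (\<exists>f. (\<exists>u\<in>I. f u \<noteq> 0) \<and> (\<forall>u\<in>I. mat_app I K f u = l * f u))"
  by (simp add: eigenvalue_on_def mat_app_def)

lemma cinner_on_eigenvector:
  assumes "\<forall>u\<in>I. mat_app I K f u = l * f u"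
  shows "cinner_on I g (mat_app I K f) = l * cinner_on I g f"
  using assms by (simp add: cinner_on_def sum_distrib_left mult.left_commute)

lemma cinner_on_self_pos:
  assumes "finite I" "u \<in> I" "f u \<noteq> 0"
  shows "Re (cinner_on I f f) > 0"
  unfolding cinner_on_self Re_complex_of_real
  by (rule sum_pos2[OF assms(1,2)]) (use assms(3) in auto)

text \<open>
  Eigenvectors of distinct real eigenvalues are orthogonal. Bessel's inequality for each unit vector,
  summed over the index set, bounds the number of orthonormal vectors by the number of indices.
\<close>

lemma finite_real_eigenvalues_hermitian:
  assumes I: "finite I" and K: "hermitian_on I K"
  shows "finite {x. eigenvalue_on I K (complex_of_real x)}"
proof -
  let ?S = "{x. eigenvalue_on I K (complex_of_real x)}"
  have "\<exists>f. cinner_on I f f = 1 \<and> (\<forall>u\<in>I. mat_app I K f u = of_real x * f u)" if "x \<in> ?S" for x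
  proof -
    from that obtain g w where w: "w \<in> I" "g w \<noteq> 0"
      and g: "\<forall>u\<in>I. mat_app I K g u = of_real x * g u"
      by (auto simp: eigenvalue_on_mat_app)
    define s where "s = (\<Sum>u\<in>I. (cmod (g u))\<^sup>2)"
    have s: "s > 0" using cinner_on_self_pos[OF I w(1), of g] w(2) by (simp add: cinner_on_self s_def)
    define c where "c = complex_of_real (1 / sqrt s)"
    have "c * c * of_real s = 1" using s
      by (simp add: c_def flip: of_real_mult)
    moreover have "cinner_on I g g = of_real s" by (simp add: cinner_on_self s_def)
    moreover have "cnj c = c" by (simp add: c_def)
    ultimately have "cinner_on I (\<lambda>u. c * g u) (\<lambda>u. c * g u) = 1"
      by (simp add: cinner_on_linear mult_ac)
    moreover have "\<forall>u\<in>I. mat_app I K (\<lambda>u. c * g u) u = of_real x * (c * g u)"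
      using g by (simp add: mat_app_scale)
    ultimately show ?thesis by blast
  qed
  then obtain F where F1: "\<And>x. x \<in> ?S \<Longrightarrow> cinner_on I (F x) (F x) = 1"
    and FE: "\<And>x. x \<in> ?S \<Longrightarrow> \<forall>u\<in>I. mat_app I K (F x) u = of_real x * F x u"
    by metis
  have orth: "cinner_on I (F x) (F y) = 0" if "x \<in> ?S" "y \<in> ?S" "x \<noteq> y" for x y
  proof -
    have "of_real y * cinner_on I (F x) (F y) = cinner_on I (F x) (mat_app I K (F y))"
      using cinner_on_eigenvector[OF FE[OF that(2)]] by simp
    also have "\<dots> = cnj (cinner_on I (F y) (mat_app I K (F x)))"
      by (simp add: cinner_on_hermitian[OF K] flip: cinner_on_commute)
    also have "\<dots> = of_real x * cinner_on I (F x) (F y)"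
      using cinner_on_eigenvector[OF FE[OF that(1)]] by (simp flip: cinner_on_commute)
    finally show ?thesis using that(3) by simp
  qed
  have bessel: "(\<Sum>x\<in>X. (cmod (F x w))\<^sup>2) \<le> 1" if X: "finite X" "X \<subseteq> ?S" and w: "w \<in> I" for X w
  proof -
    define \<delta> where "\<delta> u = (if u = w then 1 else 0 :: complex)" for u
    \<comment> \<open>The orthogonal projection of the unit vector \<open>\<delta>\<close> onto the span of the eigenvectors in \<open>F ` X\<close>.\<close>
    define p where "p u = (\<Sum>x\<in>X. cnj (F x w) * F x u)" for u
    have p: "p = (\<lambda>u. \<Sum>x\<in>X. cnj (F x w) * F x u)" by (simp add: p_def fun_eq_iff)
    have d1: "cinner_on I \<delta> f = f w" for f
    proof -
      have "cinner_on I \<delta> f = (\<Sum>u\<in>I. if u = w then f u else 0)"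
        unfolding cinner_on_def \<delta>_def by (intro sum.cong) auto
      then show ?thesis using I w by simp
    qed
    have d2: "cinner_on I f \<delta> = cnj (f w)" for f
      using cinner_on_commute[of I f \<delta>] d1 by simp
    have Fp: "cinner_on I (F x) p = cnj (F x w)" if "x \<in> X" for x
    proof -
      have "cinner_on I (F x) p = (\<Sum>y\<in>X. cnj (F y w) * cinner_on I (F x) (F y))"
        unfolding p by (rule cinner_on_sum_right)
      also have "\<dots> = (\<Sum>y\<in>X. if y = x then cnj (F x w) else 0)"
        using X that by (intro sum.cong) (auto simp: orth F1 subset_iff)
      finally show ?thesis using that X by simp
    qed
    have pp: "cinner_on I p p = p w"
    proof -
      have "cinner_on I p p = (\<Sum>x\<in>X. F x w * cinner_on I (F x) p)"
        by (subst (1) p, subst cinner_on_sum_left) simp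
      also have "\<dots> = p w" using Fp by (simp add: p_def mult.commute)
      finally show ?thesis .
    qed
    have pw: "p w = of_real (\<Sum>x\<in>X. (cmod (F x w))\<^sup>2)"
      unfolding p_def of_real_sum complex_norm_square by (intro sum.cong refl mult.commute)
    have "0 \<le> Re (cinner_on I (\<lambda>u. \<delta> u + (-1) * p u) (\<lambda>u. \<delta> u + (-1) * p u))"
      unfolding cinner_on_self by (simp add: sum_nonneg)
    also have "\<dots> = 1 - (\<Sum>x\<in>X. (cmod (F x w))\<^sup>2)"
      unfolding cinner_on_linear using pp pw d1 d2 by (simp add: \<delta>_def)
    finally show ?thesis by simp
  qed
  have "card X \<le> card I" if X: "finite X" "X \<subseteq> ?S" for X
  proof -
    have one: "(\<Sum>u\<in>I. (cmod (F x u))\<^sup>2) = 1" if "x \<in> X" for x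
    proof -
      have "cinner_on I (F x) (F x) = 1" using F1 X that by blast
      then show ?thesis unfolding cinner_on_self by (simp only: of_real_eq_1_iff)
    qed
    have "real (card X) = (\<Sum>x\<in>X. 1)" by simp
    also have "\<dots> = (\<Sum>x\<in>X. \<Sum>u\<in>I. (cmod (F x u))\<^sup>2)"
      by (rule sum.cong) (simp_all only: one)
    also have "\<dots> = (\<Sum>u\<in>I. \<Sum>x\<in>X. (cmod (F x u))\<^sup>2)" by (rule sum.swap)
    also have "\<dots> \<le> real (card I)"
      using sum_bounded_above[of I "\<lambda>u. \<Sum>x\<in>X. (cmod (F x u))\<^sup>2" 1] bessel[OF X] by simp
    finally show ?thesis by (simp only: of_nat_le_iff)
  qed
  then show ?thesis by (meson finite_if_finite_subsets_card_bdd)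
qed

text \<open>
  The unit sphere of the functions supported in \<open>I\<close> is compact in the product topology, because it is
  closed in a product of disks and singletons.
\<close>

lemma rayleigh_minimum_attained:
  assumes I: "finite I" "I \<noteq> {}"
  obtains f l where "cinner_on I f f = 1" "Re (cinner_on I f (mat_app I K f)) = l"
    "\<And>g. l * Re (cinner_on I g g) \<le> Re (cinner_on I g (mat_app I K g))"
proof -
  define R where "R f = Re (cinner_on I f (mat_app I K f))" for f
  let ?P = "PiE UNIV (\<lambda>u. if u \<in> I then cball 0 1 else {0}) :: ('a \<Rightarrow> complex) set"
  let ?N = "{f :: 'a \<Rightarrow> complex. (\<Sum>u\<in>I. (cmod (f u))\<^sup>2) = 1}"
  have "compact ?P"
  proof -
    have "compactin (product_topology (\<lambda>_. euclidean) UNIV) ?P"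
      by (subst compactin_PiE) auto
    then show ?thesis by (simp add: euclidean_product_topology)
  qed
  moreover have "closed ?N"
    by (intro closed_Collect_eq continuous_intros continuous_on_product_coordinates)
  ultimately have comp: "compact (?P \<inter> ?N)" by (rule compact_Int_closed)
  obtain w where w: "w \<in> I" using I by blast
  have "(\<lambda>u. if u = w then 1 else 0) \<in> ?P \<inter> ?N"
    using I w by (auto split: if_splits simp: if_distrib[of "\<lambda>x. x\<^sup>2"] if_distrib[of cmod] cong: if_cong)
  then have ne: "?P \<inter> ?N \<noteq> {}" by blast
  have cont: "continuous_on (?P \<inter> ?N) R"
    unfolding R_def cinner_on_def mat_app_def
    by (rule continuous_on_subset[OF _ subset_UNIV])
       (intro continuous_intros continuous_on_product_coordinates)
  obtain f where f: "f \<in> ?P \<inter> ?N" and min: "\<And>g. g \<in> ?P \<inter> ?N \<Longrightarrow> R f \<le> R g"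
    using continuous_attains_inf[OF comp ne cont] by blast
  show ?thesis
  proof (rule that[of f "R f"])
    show "cinner_on I f f = 1" using f by (simp add: cinner_on_self)
    fix g
    let ?s = "\<Sum>u\<in>I. (cmod (g u))\<^sup>2"
    show "R f * Re (cinner_on I g g) \<le> Re (cinner_on I g (mat_app I K g))"
    proof (cases "?s = 0")
      case True
      then have "\<forall>u\<in>I. g u = 0" using I by (simp add: sum_nonneg_eq_0_iff)
      then show ?thesis by (simp add: cinner_on_def)
    next
      case False
      then have s: "?s > 0" by (simp add: sum_nonneg less_le)
      define c where "c = complex_of_real (1 / sqrt ?s)"
      define h where "h u = (if u \<in> I then c * g u else 0)" for u
      have cc: "cnj c * c = of_real (1 / ?s)"
        using s by (simp add: c_def sum_nonneg flip: of_real_mult)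
      have eqI: "cinner_on I h h' = cinner_on I (\<lambda>u. c * g u) h'" for h'
        by (simp add: cinner_on_def h_def)
      have eqK: "mat_app I K h = mat_app I K (\<lambda>u. c * g u)"
        by (rule ext) (simp add: mat_app_def h_def)
      have "cinner_on I h h = cinner_on I (\<lambda>u. c * g u) (\<lambda>u. c * g u)"
        by (simp add: cinner_on_def h_def)
      also have "\<dots> = cnj c * c * of_real ?s"
        by (simp add: cinner_on_linear cinner_on_self mult_ac)
      finally have hh: "cinner_on I h h = 1" unfolding cc using s by (simp flip: of_real_mult of_real_sum of_real_power)
      then have hN: "(\<Sum>u\<in>I. (cmod (h u))\<^sup>2) = 1"
        unfolding cinner_on_self by (metis of_real_eq_1_iff)
      have "cmod (h u) \<le> 1" if "u \<in> I" for u
      proof -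
        have "(cmod (h u))\<^sup>2 \<le> (\<Sum>u\<in>I. (cmod (h u))\<^sup>2)"
          by (rule member_le_sum) (use I that in auto)
        then show ?thesis using hN by (simp add: power_le_one_iff abs_square_le_1)
      qed
      then have "h \<in> ?P \<inter> ?N" using hN by (auto simp: h_def)
      then have "R f \<le> R h" by (rule min)
      also have "R h = Re (cnj c * c * cinner_on I g (mat_app I K g))"
        unfolding R_def eqI eqK mat_app_scale cinner_on_linear by (simp add: mult_ac)
      also have "\<dots> = Re (cinner_on I g (mat_app I K g)) / ?s"
        unfolding cc by (simp add: divide_inverse mult.commute flip: of_real_sum of_real_power of_real_inverse)
      finally show ?thesis using s by (simp add: cinner_on_self field_simps)
    qed
  qed (simp add: R_def)
qed

text \<open>
  The first-order condition at a minimum: near \<open>t = 0\<close> the linear term dominates, and a negative \<open>t\<close>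
  would make the sum negative.
\<close>

lemma quadratic_nonneg_imp_linear_zero:
  fixes a c :: real
  assumes "\<And>t. 0 \<le> 2 * t * a + t\<^sup>2 * c" "a \<ge> 0"
  shows "a = 0"
proof (rule ccontr)
  assume "a \<noteq> 0"
  \<comment> \<open>The denominator makes \<open>\<bar>t c\<bar> \<le> a\<close>, so that the bracket in \<open>t (2 a + t c)\<close> stays positive.\<close>
  define t where "t = - a / (\<bar>c\<bar> + 1)"
  have "0 \<le> t * (2 * a + t * c)" using assms(1)[of t] by (simp add: power2_eq_square algebra_simps)
  moreover have "t < 0" using \<open>a \<noteq> 0\<close> \<open>a \<ge> 0\<close> by (simp add: t_def field_simps add_pos_nonneg)
  ultimately have "2 * a + t * c \<le> 0" by (simp add: zero_le_mult_iff)
  moreover have "\<bar>t * c\<bar> \<le> a"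
    using \<open>a \<ge> 0\<close> by (simp add: t_def abs_mult field_simps)
  ultimately show False using \<open>a \<noteq> 0\<close> \<open>a \<ge> 0\<close> by linarith
qed

text \<open>
  A minimizer \<open>f\<close> of the Rayleigh quotient, with minimum \<open>l\<close>, is an eigenvector: varying \<open>f\<close> in the direction
  of its own residual \<open>r = K f - l f\<close> changes the quotient to first order by \<open>2 t \<parallel>r\<parallel>\<^sup>2\<close>, so \<open>r\<close> vanishes. The
  smallest eigenvalue is then at most \<open>l\<close>.
\<close>

lemma hermitian_min_eigenvalue:
  assumes I: "finite I" "I \<noteq> {}" and K: "hermitian_on I K"
  defines "S \<equiv> {x. eigenvalue_on I K (complex_of_real x)}"
  shows "finite S" "S \<noteq> {}"
    and "Min S * (\<Sum>u\<in>I. (cmod (g u))\<^sup>2) \<le> Re (cinner_on I g (mat_app I K g))"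
proof -
  show fin: "finite S" unfolding S_def by (rule finite_real_eigenvalues_hermitian[OF I(1) K])
  obtain f l where f1: "cinner_on I f f = 1" and fl: "Re (cinner_on I f (mat_app I K f)) = l"
    and min: "\<And>g. l * Re (cinner_on I g g) \<le> Re (cinner_on I g (mat_app I K g))"
    using rayleigh_minimum_attained[OF I] by metis
  define r where "r u = mat_app I K f u + of_real (- l) * f u" for u
  have r: "Re (cinner_on I r r) = 0"
  proof (rule quadratic_nonneg_imp_linear_zero)
    fix t :: real
    let ?g = "\<lambda>u. f u + of_real t * r u"
    have 1: "cinner_on I f (mat_app I K r) = cinner_on I (mat_app I K f) r" by (rule cinner_on_hermitian[OF K])
    have 2: "cinner_on I (mat_app I K f) r = cnj (cinner_on I r (mat_app I K f))" by (rule cinner_on_commute)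
    have 3: "cinner_on I f r = cnj (cinner_on I r f)" by (rule cinner_on_commute)
    have 4: "Re (cinner_on I r (mat_app I K f)) = Re (cinner_on I r r) + l * Re (cinner_on I r f)"
    proof -
      have "cinner_on I r r = cinner_on I r (\<lambda>u. mat_app I K f u + of_real (- l) * f u)"
        by (simp add: r_def cinner_on_def)
      then show ?thesis unfolding cinner_on_linear by simp
    qed
    have R: "Re (cinner_on I ?g (mat_app I K ?g)) = l + 2 * t * Re (cinner_on I r (mat_app I K f))
        + t\<^sup>2 * Re (cinner_on I r (mat_app I K r))"
      unfolding mat_app_add mat_app_scale cinner_on_linear 1 2
      using fl by (simp add: power2_eq_square)
    have N: "Re (cinner_on I ?g ?g) = 1 + 2 * t * Re (cinner_on I r f) + t\<^sup>2 * Re (cinner_on I r r)"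
      unfolding cinner_on_linear 3 using f1 by (simp add: power2_eq_square)
    have "0 \<le> Re (cinner_on I ?g (mat_app I K ?g)) - l * Re (cinner_on I ?g ?g)" using min[of ?g] by simp
    also have "\<dots> = 2 * t * Re (cinner_on I r r) + t\<^sup>2 * (Re (cinner_on I r (mat_app I K r)) - l * Re (cinner_on I r r))"
      unfolding R N 4 by (simp add: algebra_simps)
    finally show "0 \<le> 2 * t * Re (cinner_on I r r) + t\<^sup>2 * (Re (cinner_on I r (mat_app I K r)) - l * Re (cinner_on I r r))" .
  qed (simp add: cinner_on_self sum_nonneg)
  have "\<forall>u\<in>I. r u = 0" using r I by (simp add: cinner_on_self sum_nonneg_eq_0_iff)
  moreover have "\<exists>u\<in>I. f u \<noteq> 0" 
  proof (rule ccontr)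
    assume "\<not> (\<exists>u\<in>I. f u \<noteq> 0)"
    then have "cinner_on I f f = 0" by (simp add: cinner_on_def)
    then show False using f1 by simp
  qed
  ultimately have "l \<in> S" unfolding S_def eigenvalue_on_mat_app
    by (auto simp: r_def intro!: exI[of _ f])
  then show "S \<noteq> {}" by blast
  have "Min S \<le> l" using fin \<open>l \<in> S\<close> by simp
  then have "Min S * Re (cinner_on I g g) \<le> l * Re (cinner_on I g g)"
    by (rule mult_right_mono) (simp add: cinner_on_self sum_nonneg flip: of_real_sum of_real_power)
  also note min[of g]
  finally show "Min S * (\<Sum>u\<in>I. (cmod (g u))\<^sup>2) \<le> Re (cinner_on I g (mat_app I K g))"
    by (simp add: cinner_on_self)
qed

section \<open>Finite graphs with indexed arcs\<close>

text \<open>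
  The features of the fundamental graph on which the estimates depend. The map \<open>flip\<close> reverses
  arcs; the arcs of zero index contain a spanning tree. Some arc has nonzero index, which excludes
  a single vertex without arcs, where the degree would vanish.
\<close>

locale indexed_graph = fin_digraph Q
  for Q :: "('v,'a) pre_digraph" +
  fixes flip :: "'a \<Rightarrow> 'a" and \<tau> :: "'a \<Rightarrow> real^'d"
  assumes flip_in_arcs [simp]: "a \<in> arcs Q \<Longrightarrow> flip a \<in> arcs Q"
    and flip_flip [simp]: "a \<in> arcs Q \<Longrightarrow> flip (flip a) = a"
    and tail_flip [simp]: "a \<in> arcs Q \<Longrightarrow> tail Q (flip a) = head Q a"
    and index_flip [simp]: "a \<in> arcs Q \<Longrightarrow> \<tau> (flip a) = - \<tau> a"
    and zero_connected: "strongly_connected (Q\<lparr>arcs := {a \<in> arcs Q. \<tau> a = 0}\<rparr>)"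
    and index_nonzero: "\<exists>a\<in>arcs Q. \<tau> a \<noteq> 0"
begin

abbreviation deg :: "'v \<Rightarrow> real" where "deg v \<equiv> real (out_degree Q v)"

definition total_degree :: real where "total_degree = (\<Sum>v\<in>verts Q. deg v)"

definition phase :: "real^'d \<Rightarrow> 'a \<Rightarrow> complex" where
  "phase \<theta> a = exp (\<i> * of_real (\<tau> a \<bullet> \<theta>))"

text \<open>
  The phases are not absorbed into \<open>h\<close>, so that \<open>h\<close> lives on the quotient and is compared with itself
  along cycles.
\<close>

definition defect :: "real^'d \<Rightarrow> ('v \<Rightarrow> complex) \<Rightarrow> 'a \<Rightarrow> real" where
  "defect \<theta> h a = cmod (h (tail Q a) - phase \<theta> a * h (head Q a))"

definition energy :: "real^'d \<Rightarrow> ('v \<Rightarrow> complex) \<Rightarrow> real" where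
  "energy \<theta> h = (\<Sum>a\<in>arcs Q. (defect \<theta> h a)\<^sup>2) / 2"

lemma head_flip [simp]: "a \<in> arcs Q \<Longrightarrow> head Q (flip a) = tail Q a"
  using tail_flip[of "flip a"] by simp

lemma sum_flip: "(\<Sum>a\<in>arcs Q. f (flip a)) = (\<Sum>a\<in>arcs Q. f a)"
  by (rule sum.reindex_bij_witness[of _ flip flip]) auto

lemma norm_phase [simp]: "cmod (phase \<theta> a) = 1"
  by (simp add: phase_def)

lemma phase_flip: "a \<in> arcs Q \<Longrightarrow> phase \<theta> (flip a) = cnj (phase \<theta> a)"
  by (simp add: phase_def exp_cnj)

lemma phase_cnj: "phase \<theta> a * cnj (phase \<theta> a) = 1"
  using complex_norm_square[of "phase \<theta> a"] by simp

lemma defect_nonneg [simp]: "0 \<le> defect \<theta> h a"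
  by (simp add: defect_def)

lemma defect_flip:
  assumes "a \<in> arcs Q" shows "defect \<theta> h (flip a) = defect \<theta> h a"
proof -
  have "h (head Q a) - cnj (phase \<theta> a) * h (tail Q a)
      = - cnj (phase \<theta> a) * (h (tail Q a) - phase \<theta> a * h (head Q a))"
    using phase_cnj[of \<theta> a] by (simp add: algebra_simps)
  then show ?thesis
    by (simp add: defect_def phase_flip assms norm_mult del: mult_minus_left)
qed

text \<open>
  Arcs of zero index carry no phase, so along them the defect measures the variation of \<open>h\<close>.
\<close>

lemma defect_zero_index: "\<tau> a = 0 \<Longrightarrow> defect \<theta> h a = cmod (h (tail Q a) - h (head Q a))"
  by (simp add: defect_def phase_def)

lemma energy_nonneg: "0 \<le> energy \<theta> h"
  by (simp add: energy_def sum_nonneg)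

lemma verts_nonempty: "verts Q \<noteq> {}"
  using zero_connected by (simp add: strongly_connected_def)

lemma sum_tails: "(\<Sum>a\<in>arcs Q. f (tail Q a)) = (\<Sum>v\<in>verts Q. deg v * f v)"
  for f :: "'v \<Rightarrow> real"
proof -
  have "(\<Sum>v\<in>verts Q. deg v * f v) = (\<Sum>v\<in>verts Q. \<Sum>a\<in>{a \<in> arcs Q. tail Q a = v}. f (tail Q a))"
    by (intro sum.cong refl) (simp add: out_degree_def out_arcs_def)
  also have "\<dots> = (\<Sum>a\<in>arcs Q. f (tail Q a))"
    by (rule sum.group) auto
  finally show ?thesis by simp
qed

lemma sum_ends:
  "(\<Sum>u\<in>verts Q. \<Sum>v\<in>verts Q. \<Sum>a\<in>{a \<in> arcs Q. tail Q a = u \<and> head Q a = v}. f a) = (\<Sum>a\<in>arcs Q. f a)"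
  for f :: "'a \<Rightarrow> complex"
proof -
  have "(\<Sum>u\<in>verts Q. \<Sum>v\<in>verts Q. \<Sum>a\<in>{a \<in> arcs Q. tail Q a = u \<and> head Q a = v}. f a)
     = (\<Sum>w\<in>verts Q \<times> verts Q. \<Sum>a\<in>{a \<in> arcs Q. (tail Q a, head Q a) = w}. f a)"
    by (simp add: sum.cartesian_product case_prod_unfold prod_eq_iff)
  also have "\<dots> = (\<Sum>a\<in>arcs Q. f a)"
    by (rule sum.group) auto
  finally show ?thesis .
qed

subsection \<open>Paths of zero index\<close>

abbreviation zero_graph :: "('v,'a) pre_digraph" where
  "zero_graph \<equiv> Q\<lparr>arcs := {a \<in> arcs Q. \<tau> a = 0}\<rparr>"

lemma fin_digraph_zero_graph: "fin_digraph zero_graph"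
  by unfold_locales auto

lemma zero_walk_difference:
  assumes "pre_digraph.cas zero_graph u p v" "set p \<subseteq> arcs zero_graph"
  shows "cmod (h u - h v) \<le> (\<Sum>a\<leftarrow>p. defect \<theta> h a)"
  using assms
proof (induction p arbitrary: u)
  case Nil
  then show ?case by (simp add: pre_digraph.cas.simps)
next
  case (Cons b p)
  then have b: "\<tau> b = 0" "tail Q b = u" and p: "pre_digraph.cas zero_graph (head Q b) p v"
    by (simp_all add: pre_digraph.cas.simps)
  have "cmod (h u - h v) \<le> cmod (h u - h (head Q b)) + cmod (h (head Q b) - h v)"
    using norm_triangle_ineq[of "h u - h (head Q b)" "h (head Q b) - h v"] by simp
  moreover have "cmod (h (head Q b) - h v) \<le> (\<Sum>a\<leftarrow>p. defect \<theta> h a)"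
    using Cons.IH[OF p] Cons.prems(2) by simp
  ultimately show ?case using b by (simp add: defect_zero_index)
qed

text \<open>
  An arc and its reversal cannot both occur in a path without repeated vertices. This matters because the
  energy counts every unoriented edge once, as half the sum over the two arcs.
\<close>

lemma zero_path_no_flip:
  assumes "pre_digraph.apath zero_graph u p v" "a \<in> set p"
  shows "flip a \<notin> set p"
  using assms
proof (induction p arbitrary: u a)
  case (Cons b p)
  interpret Z: fin_digraph zero_graph by (rule fin_digraph_zero_graph)
  from Cons.prems(1) have b: "b \<in> arcs Q" "tail Q b = u"
    and p: "Z.apath (head Q b) p v" and u: "u \<notin> set (Z.awalk_verts (head Q b) p)"
    by (auto simp: Z.apath_Cons_iff)
  have walk: "Z.awalk (head Q b) p v" using p by (rule Z.awalkI_apath)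
  have tail: "tail Q c \<noteq> u" if "c \<in> set p" for c
    using Z.awalk_verts_arc1[OF that, of "head Q b"] u by auto
  have head: "head Q c \<noteq> u" if "c \<in> set p" for c
    using Z.awalk_verts_arc2[OF walk that] u by auto
  have arcs: "c \<in> arcs Q" if "c \<in> set p" for c
    using walk that by (auto simp: Z.awalk_def)
  have "head Q b \<in> set (Z.awalk_verts (head Q b) p)" using p by (rule Z.hd_in_awalk_verts(2))
  then have "head Q b \<noteq> u" using u by metis
  then have "flip b \<noteq> b" using tail_flip[OF b(1)] b(2) by metis
  moreover have "flip b \<notin> set p" using head[of "flip b"] head_flip[OF b(1)] b(2) by metis
  moreover have "flip c \<noteq> b" if "c \<in> set p" for c
    using head[OF that] tail_flip[OF arcs[OF that]] b(2) by metis
  moreover have "flip c \<notin> set p" if "c \<in> set p" for c using Cons.IH[OF p that] .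
  ultimately show ?case using Cons.prems(2) by (metis set_ConsD)
qed simp

lemma obtain_zero_path:
  assumes "u \<in> verts Q" "v \<in> verts Q"
  obtains P where "P \<subseteq> arcs Q" "\<And>a. a \<in> P \<Longrightarrow> \<tau> a = 0" "\<And>a. a \<in> P \<Longrightarrow> flip a \<notin> P"
    "card P < card (verts Q)" "\<And>\<theta> h. cmod (h u - h v) \<le> (\<Sum>a\<in>P. defect \<theta> h a)"
    "u \<noteq> v \<Longrightarrow> \<exists>a\<in>P. tail Q a = u"
proof -
  interpret Z: fin_digraph zero_graph by (rule fin_digraph_zero_graph)
  have "u \<rightarrow>\<^sup>*\<^bsub>zero_graph\<^esub> v" using zero_connected assms by (auto simp: strongly_connected_def)
  then obtain p where p: "Z.apath u p v" using Z.reachable_apath by blast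
  then have walk: "Z.awalk u p v" by (rule Z.awalkI_apath)
  then have arcs: "set p \<subseteq> arcs zero_graph" and cas: "Z.cas u p v"
    by (simp_all add: Z.awalk_def)
  have dist: "distinct p" using p Z.distinct_verts_imp_distinct[OF walk] by (simp add: Z.apath_def)
  show ?thesis
  proof (rule that[of "set p"])
    show "card (set p) < card (verts Q)"
      using Z.length_apath_less[OF p] by (simp add: distinct_card[OF dist])
    show "cmod (h u - h v) \<le> (\<Sum>a\<in>set p. defect \<theta> h a)" for \<theta> h
      using zero_walk_difference[OF cas arcs, of h \<theta>] by (simp add: sum_list_distinct_conv_sum_set[OF dist])
    show "\<exists>a\<in>set p. tail Q a = u" if "u \<noteq> v"
      using cas that by (cases p) auto
    show "flip a \<notin> set p" if "a \<in> set p" for a by (rule zero_path_no_flip[OF p that])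
  qed (use arcs in auto)
qed

text \<open>
  A vertex other than the tail of an arc of nonzero index is joined to it by a path of zero index, whose
  first arc starts at the vertex.
\<close>

lemma deg_pos: "v \<in> verts Q \<Longrightarrow> 0 < deg v"
proof -
  assume v: "v \<in> verts Q"
  obtain a where a: "a \<in> arcs Q" using index_nonzero by blast
  have "\<exists>b\<in>arcs Q. tail Q b = v"
  proof (cases "v = tail Q a")
    case False
    show ?thesis by (rule obtain_zero_path[OF v tail_in_verts[OF a]]) (use False in blast)
  qed (use a in blast)
  then have "out_arcs Q v \<noteq> {}" by auto
  then show ?thesis using finite_out_arcs[of v] by (simp add: out_degree_def card_gt_0_iff)
qed

lemma total_degree_pos: "0 < total_degree"
  unfolding total_degree_def using verts_nonempty deg_pos by (intro sum_pos) auto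

subsection \<open>The first band as a minimal energy\<close>

lemma hermitian_floquet: "hermitian_on (verts Q) (floquet_matrix Q \<tau> \<theta>)"
  unfolding hermitian_on_def
proof (intro ballI)
  fix u v
  have "(\<Sum>a\<in>{a \<in> arcs Q. tail Q a = v \<and> head Q a = u}. phase \<theta> a)
      = (\<Sum>a\<in>{a \<in> arcs Q. tail Q a = u \<and> head Q a = v}. cnj (phase \<theta> a))"
    by (rule sum.reindex_bij_witness[of _ flip flip]) (auto simp: phase_flip)
  then show "floquet_matrix Q \<tau> \<theta> v u = cnj (floquet_matrix Q \<tau> \<theta> u v)"
    by (simp add: floquet_matrix_def mult.commute flip: phase_def)
qed

text \<open>
  The substitution \<open>g = \<kappa>\<^sup>1\<^sup>/\<^sup>2 h\<close> removes the normalizing square roots. Expanding the squares in the energy,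
  the terms at heads and at tails have the same sum, by reversal of arcs, and together they give the
  identity part of the matrix.
\<close>

lemma floquet_form:
  assumes g: "\<And>v. v \<in> verts Q \<Longrightarrow> g v = of_real (sqrt (deg v)) * h v"
  shows "Re (cinner_on (verts Q) g (mat_app (verts Q) (floquet_matrix Q \<tau> \<theta>) g)) = energy \<theta> h"
proof -
  let ?V = "verts Q"
  have deg1: "of_real (sqrt (deg u)) * of_real (sqrt (deg v)) / of_real (sqrt (deg u * deg v)) = (1::complex)"
    if "u \<in> ?V" "v \<in> ?V" for u v
    using deg_pos[OF that(1)] deg_pos[OF that(2)] by (simp add: real_sqrt_mult)
  have entry: "cnj (g u) * (floquet_matrix Q \<tau> \<theta> u v * g v) =
      (if u = v then of_real (deg u * (cmod (h u))\<^sup>2) else 0)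
      - (\<Sum>a\<in>{a \<in> arcs Q. tail Q a = u \<and> head Q a = v}. cnj (h (tail Q a)) * phase \<theta> a * h (head Q a))"
    if "u \<in> ?V" "v \<in> ?V" for u v
  proof -
    let ?S = "\<Sum>a\<in>{a \<in> arcs Q. tail Q a = u \<and> head Q a = v}. phase \<theta> a"
    have "(\<Sum>a\<in>{a \<in> arcs Q. tail Q a = u \<and> head Q a = v}. cnj (h (tail Q a)) * phase \<theta> a * h (head Q a))
        = cnj (h u) * h v * ?S"
      unfolding sum_distrib_left by (intro sum.cong) (auto simp: mult_ac)
    moreover have "cnj (g u) * (1 / of_real (sqrt (deg u * deg v)) * ?S * g v)
        = (of_real (sqrt (deg u)) * of_real (sqrt (deg v)) / of_real (sqrt (deg u * deg v))) * (cnj (h u) * h v * ?S)"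
      using that by (simp add: g)
    moreover have "cnj (g u) * g u = of_real (deg u * (cmod (h u))\<^sup>2)"
    proof -
      have "cnj (g u) * g u = of_real ((cmod (g u))\<^sup>2)"
        by (simp only: complex_norm_square mult.commute)
      also have "(cmod (g u))\<^sup>2 = deg u * (cmod (h u))\<^sup>2"
        using that by (simp add: g norm_mult power_mult_distrib)
      finally show ?thesis .
    qed
    ultimately show ?thesis unfolding floquet_matrix_def phase_def[symmetric] deg1[OF that]
      by (auto simp: left_diff_distrib right_diff_distrib)
  qed
  have "cinner_on ?V g (mat_app ?V (floquet_matrix Q \<tau> \<theta>) g)
      = (\<Sum>u\<in>?V. \<Sum>v\<in>?V. cnj (g u) * (floquet_matrix Q \<tau> \<theta> u v * g v))"
    by (simp add: cinner_on_def mat_app_def sum_distrib_left)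
  also have "\<dots> = (\<Sum>u\<in>?V. of_real (deg u * (cmod (h u))\<^sup>2))
      - (\<Sum>a\<in>arcs Q. cnj (h (tail Q a)) * phase \<theta> a * h (head Q a))"
    unfolding sum_ends[symmetric] sum_subtractf[symmetric]
    by (intro sum.cong refl) (simp add: entry sum_subtractf)
  finally have "Re (cinner_on ?V g (mat_app ?V (floquet_matrix Q \<tau> \<theta>) g))
      = (\<Sum>a\<in>arcs Q. (cmod (h (tail Q a)))\<^sup>2)
        - (\<Sum>a\<in>arcs Q. Re (cnj (h (tail Q a)) * phase \<theta> a * h (head Q a)))"
    using sum_tails[of "\<lambda>v. (cmod (h v))\<^sup>2"] by simp
  also have "\<dots> = energy \<theta> h"
  proof -
    have sq: "(defect \<theta> h a)\<^sup>2 = (cmod (h (tail Q a)))\<^sup>2 + (cmod (h (head Q a)))\<^sup>2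
       - 2 * Re (cnj (h (tail Q a)) * phase \<theta> a * h (head Q a))" for a
    proof -
      have "(cmod (x - y))\<^sup>2 = (cmod x)\<^sup>2 + (cmod y)\<^sup>2 - 2 * Re (cnj x * y)" for x y :: complex
        unfolding cmod_power2 by (simp add: power2_eq_square algebra_simps)
      then show ?thesis by (simp add: defect_def norm_mult mult.assoc)
    qed
    have "(\<Sum>a\<in>arcs Q. (cmod (h (head Q a)))\<^sup>2) = (\<Sum>a\<in>arcs Q. (cmod (h (tail Q a)))\<^sup>2)"
      by (subst (2) sum_flip[symmetric]) simp
    then show ?thesis
      unfolding energy_def sq by (simp add: sum.distrib sum_subtractf flip: sum_distrib_left)
  qed
  finally show ?thesis .
qed

lemma sum_deg_norm:
  assumes g: "\<And>v. v \<in> verts Q \<Longrightarrow> g v = of_real (sqrt (deg v)) * h v"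
  shows "(\<Sum>v\<in>verts Q. (cmod (g v))\<^sup>2) = (\<Sum>v\<in>verts Q. deg v * (cmod (h v))\<^sup>2)"
  by (intro sum.cong refl) (simp add: g norm_mult power_mult_distrib)

lemma first_band_le: "first_band Q \<tau> \<theta> * (\<Sum>v\<in>verts Q. deg v * (cmod (h v))\<^sup>2) \<le> energy \<theta> h"
  using hermitian_min_eigenvalue(3)[OF finite_verts verts_nonempty hermitian_floquet, of \<theta>
      "\<lambda>v. of_real (sqrt (deg v)) * h v"]
  by (simp add: first_band_def floquet_form[of _ h] sum_deg_norm[of _ h])

lemma first_band_attained:
  obtains h where "(\<Sum>v\<in>verts Q. deg v * (cmod (h v))\<^sup>2) = 1" "energy \<theta> h = first_band Q \<tau> \<theta>"
proof -
  let ?V = "verts Q" and ?K = "floquet_matrix Q \<tau> \<theta>" and ?l = "first_band Q \<tau> \<theta>"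
  have "?l \<in> {x. eigenvalue_on ?V ?K (complex_of_real x)}"
    unfolding first_band_def
    by (intro Min_in hermitian_min_eigenvalue(1,2) finite_verts verts_nonempty hermitian_floquet)
  then obtain f w where w: "w \<in> ?V" "f w \<noteq> 0" and f: "\<forall>u\<in>?V. mat_app ?V ?K f u = of_real ?l * f u"
    by (auto simp: eigenvalue_on_mat_app)
  define s where "s = (\<Sum>v\<in>?V. (cmod (f v))\<^sup>2)"
  have s: "s > 0" using cinner_on_self_pos[OF finite_verts w(1), of f] w(2) by (simp add: cinner_on_self s_def)
  define g where "g v = complex_of_real (1 / sqrt s) * f v" for v
  define h where "h v = g v / of_real (sqrt (deg v))" for v
  have gh: "g v = of_real (sqrt (deg v)) * h v" if "v \<in> ?V" for v
    using deg_pos[OF that] by (simp add: h_def)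
  have "(\<Sum>v\<in>?V. (cmod (g v))\<^sup>2) = (\<Sum>v\<in>?V. (cmod (f v))\<^sup>2 / s)"
    using s by (intro sum.cong) (simp_all add: g_def norm_mult norm_divide power_divide)
  also have "\<dots> = 1" using s by (simp add: s_def flip: sum_divide_distrib)
  finally have 1: "(\<Sum>v\<in>?V. (cmod (g v))\<^sup>2) = 1" .
  have "\<forall>u\<in>?V. mat_app ?V ?K g u = of_real ?l * g u"
  proof -
    have "g = (\<lambda>v. complex_of_real (1 / sqrt s) * f v)" by (rule ext) (rule g_def)
    then have "mat_app ?V ?K g = (\<lambda>u. complex_of_real (1 / sqrt s) * mat_app ?V ?K f u)"
      by (simp only: mat_app_scale)
    then show ?thesis using f by (simp add: g_def)
  qed
  then have "cinner_on ?V g (mat_app ?V ?K g) = of_real ?l * cinner_on ?V g g" by (rule cinner_on_eigenvector)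
  then have "energy \<theta> h = ?l" using 1 floquet_form[OF gh, of \<theta>] by (simp add: cinner_on_self)
  with 1 show ?thesis using sum_deg_norm[OF gh] that by simp
qed

end

section \<open>Bounds on the effective form\<close>

lemma sum_edge_orientation:
  fixes f :: "'a \<Rightarrow> real"
  assumes "edge_orientation Q flip E" "finite (arcs Q)"
    and flip: "\<And>a. a \<in> arcs Q \<Longrightarrow> flip a \<in> arcs Q" "\<And>a. a \<in> arcs Q \<Longrightarrow> flip (flip a) = a"
    and f: "\<And>a. a \<in> arcs Q \<Longrightarrow> f (flip a) = f a"
  shows "(\<Sum>a\<in>arcs Q. f a) = 2 * (\<Sum>a\<in>E. f a)"
proof -
  have E: "E \<subseteq> arcs Q" "\<And>a. a \<in> arcs Q \<Longrightarrow> a \<in> E \<longleftrightarrow> flip a \<notin> E"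
    using assms(1) by (auto simp: edge_orientation_def)
  have "(\<Sum>a\<in>arcs Q - E. f a) = (\<Sum>a\<in>E. f a)"
    by (rule sum.reindex_bij_witness[of _ flip flip]) (use E flip f in \<open>auto simp: subset_iff\<close>)
  then show ?thesis using sum.subset_diff[OF E(1) assms(2), of f] by simp
qed

lemma effective_form_tendsto:
  assumes "effective_form band \<mu>" "norm \<omega> = 1"
  shows "((\<lambda>\<epsilon>. band (\<epsilon> *\<^sub>R \<omega>) / \<epsilon>\<^sup>2) \<longlongrightarrow> \<mu> \<omega>) (at_right 0)"
proof -
  from assms have "(\<lambda>\<epsilon>. band (\<epsilon> *\<^sub>R \<omega>) - \<epsilon>\<^sup>2 * \<mu> \<omega>) \<in> O[at_right 0](\<lambda>\<epsilon>. \<epsilon> ^ 3)"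
    by (simp add: effective_form_def)
  then obtain c where c: "\<forall>\<^sub>F \<epsilon> in at_right 0. norm (band (\<epsilon> *\<^sub>R \<omega>) - \<epsilon>\<^sup>2 * \<mu> \<omega>) \<le> c * norm (\<epsilon> ^ 3)"
    using landau_o.bigE by blast
  have pos: "\<forall>\<^sub>F \<epsilon> in at_right 0. (\<epsilon>::real) > 0" by (simp add: eventually_at_filter)
  show ?thesis
  proof (rule Lim_transform_eventually)
    have "((\<lambda>\<epsilon>. band (\<epsilon> *\<^sub>R \<omega>) / \<epsilon>\<^sup>2 - \<mu> \<omega>) \<longlongrightarrow> 0) (at_right 0)"
    proof (rule Lim_null_comparison)
      show "\<forall>\<^sub>F \<epsilon> in at_right 0. norm (band (\<epsilon> *\<^sub>R \<omega>) / \<epsilon>\<^sup>2 - \<mu> \<omega>) \<le> c * \<epsilon>"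
        using c pos
      proof eventually_elim
        case (elim \<epsilon>)
        then have "band (\<epsilon> *\<^sub>R \<omega>) / \<epsilon>\<^sup>2 - \<mu> \<omega> = (band (\<epsilon> *\<^sub>R \<omega>) - \<epsilon>\<^sup>2 * \<mu> \<omega>) / \<epsilon>\<^sup>2"
          by (simp add: field_simps)
        with elim show ?case
          by (simp add: abs_mult pos_divide_le_eq power2_eq_square power3_eq_cube mult_ac)
      qed
      show "((\<lambda>\<epsilon>. c * \<epsilon>) \<longlongrightarrow> 0) (at_right 0)"
        by (rule tendsto_eq_intros refl | simp)+
    qed
    from tendsto_add[OF this tendsto_const[of "\<mu> \<omega>"]]
    show "((\<lambda>\<epsilon>. band (\<epsilon> *\<^sub>R \<omega>) / \<epsilon>\<^sup>2 - \<mu> \<omega> + \<mu> \<omega>) \<longlongrightarrow> \<mu> \<omega>) (at_right 0)" by simp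
  qed simp
qed

text \<open>
  The phase factor satisfies \<open>\<bar>exp(i t) - 1\<bar> = 2 \<bar>sin(t/2)\<bar>\<close>, hence this limit.
\<close>

lemma sin_quotient_tendsto: "((\<lambda>\<epsilon>. 2 * sin (\<epsilon> * x / 2) / \<epsilon>) \<longlongrightarrow> x) (at_right (0::real))"
proof -
  have "((\<lambda>\<epsilon>. 2 * sin (\<epsilon> * x / 2)) has_real_derivative x) (at 0)"
    by (auto intro!: derivative_eq_intros)
  then have "((\<lambda>\<epsilon>. 2 * sin (\<epsilon> * x / 2) / \<epsilon>) \<longlongrightarrow> x) (at 0)"
    by (simp add: has_field_derivative_iff)
  then show ?thesis by (rule filterlim_mono) (simp_all add: at_le)
qed


context indexed_graph
begin

definition num_verts :: real where "num_verts = real (card (verts Q))"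

lemma num_verts_pos: "0 < num_verts"
  using verts_nonempty by (simp add: num_verts_def card_gt_0_iff)

text \<open>
  The reversals of the arcs in \<open>P\<close> are further arcs with the same defects, so the squares over \<open>P\<close> alone
  sum to at most the energy, in spite of its factor \<open>1/2\<close>.
\<close>

lemma sum_defect_le:
  assumes P: "P \<subseteq> arcs Q" "\<And>a. a \<in> P \<Longrightarrow> flip a \<notin> P" and card: "card P \<le> card (verts Q)"
  shows "(\<Sum>a\<in>P. defect \<theta> h a)\<^sup>2 \<le> num_verts * energy \<theta> h"
proof -
  have fin: "finite P" by (rule finite_subset[OF P(1) finite_arcs])
  have inj: "inj_on flip P" by (rule inj_on_inverseI[of _ flip]) (use P in auto)
  have "2 * (\<Sum>a\<in>P. (defect \<theta> h a)\<^sup>2) = (\<Sum>a\<in>P. (defect \<theta> h a)\<^sup>2) + (\<Sum>a\<in>flip ` P. (defect \<theta> h a)\<^sup>2)"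
    using P by (auto simp: sum.reindex[OF inj] defect_flip subset_iff intro!: sum.cong)
  also have "\<dots> = (\<Sum>a\<in>P \<union> flip ` P. (defect \<theta> h a)\<^sup>2)"
    by (rule sum.union_disjoint[symmetric]) (use P fin in auto)
  also have "\<dots> \<le> (\<Sum>a\<in>arcs Q. (defect \<theta> h a)\<^sup>2)"
    by (rule sum_mono2) (use P in auto)
  finally have en: "(\<Sum>a\<in>P. (defect \<theta> h a)\<^sup>2) \<le> energy \<theta> h" by (simp add: energy_def)
  have "(\<Sum>a\<in>P. defect \<theta> h a)\<^sup>2 \<le> (\<Sum>a\<in>P. (defect \<theta> h a)\<^sup>2) * real (card P)"
    by (rule sum_squared_le_sum_of_squares)
  also have "\<dots> \<le> energy \<theta> h * num_verts"
    using en card energy_nonneg by (intro mult_mono) (simp_all add: num_verts_def)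
  finally show ?thesis by (simp add: mult.commute)
qed

lemma amplitude_difference_le:
  assumes "u \<in> verts Q" "v \<in> verts Q"
  shows "cmod (h u - h v) \<le> sqrt (num_verts * energy \<theta> h)"
proof (rule obtain_zero_path[OF assms])
  fix P
  assume P: "P \<subseteq> arcs Q" "\<And>a. a \<in> P \<Longrightarrow> flip a \<notin> P" "card P < card (verts Q)"
    and h: "\<And>\<theta> h. cmod (h u - h v) \<le> (\<Sum>a\<in>P. defect \<theta> h a)"
  have "(\<Sum>a\<in>P. defect \<theta> h a) \<le> sqrt (num_verts * energy \<theta> h)"
    using sum_defect_le[OF P(1,2)] P(3) by (intro real_le_rsqrt) simp
  then show ?thesis using h[of h \<theta>] by simp
qed

text \<open>
  At some vertex \<open>\<bar>h\<bar>\<^sup>2\<close> is at least its weighted mean, the reciprocal of the total degree; a path of zero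
  index carries this to every other vertex up to the square root of the energy.
\<close>

lemma amplitude_ge:
  assumes norm1: "(\<Sum>v\<in>verts Q. deg v * (cmod (h v))\<^sup>2) = 1" and u: "u \<in> verts Q"
  shows "1 / sqrt total_degree - sqrt (num_verts * energy \<theta> h) \<le> cmod (h u)"
proof -
  obtain v where v: "v \<in> verts Q" and "1 \<le> total_degree * (cmod (h v))\<^sup>2"
  proof -
    have "\<exists>v\<in>verts Q. 1 \<le> total_degree * (cmod (h v))\<^sup>2"
    proof (rule ccontr)
      assume "\<not> ?thesis"
      then have "(cmod (h v))\<^sup>2 < 1 / total_degree" if "v \<in> verts Q" for v
        using that total_degree_pos by (auto simp: field_simps not_le)
      then have "(\<Sum>v\<in>verts Q. deg v * (cmod (h v))\<^sup>2) < (\<Sum>v\<in>verts Q. deg v * (1 / total_degree))"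
        using verts_nonempty deg_pos by (intro sum_strict_mono mult_strict_left_mono) auto
      also have "\<dots> = 1" using total_degree_pos
        by (simp add: total_degree_def flip: sum_divide_distrib)
      finally show False using norm1 by simp
    qed
    then show ?thesis using that by blast
  qed
  then have "1 / total_degree \<le> (cmod (h v))\<^sup>2"
    using total_degree_pos by (simp add: field_simps)
  then have "1 / sqrt total_degree \<le> cmod (h v)"
    using real_sqrt_le_mono[of "1 / total_degree" "(cmod (h v))\<^sup>2"] by (simp add: real_sqrt_divide)
  moreover have "cmod (h v) \<le> cmod (h u) + cmod (h u - h v)"
    using norm_triangle_sub[of "h v" "h u"] by (simp add: norm_minus_commute)
  ultimately show ?thesis using amplitude_difference_le[OF u v, of h \<theta>] by linarith
qed

text \<open>
  A path of zero index from the head of \<open>a\<close> back to its tail \<open>u\<close>, preceded by \<open>a\<close>, is a cycle whose total phase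
  is that of \<open>a\<close>. Following \<open>h\<close> around it compares \<open>h(u)\<close> with its multiple by this phase.
\<close>

lemma cycle_bound:
  assumes a: "a \<in> arcs Q" "\<tau> a \<noteq> 0"
  shows "(cmod (h (tail Q a)) * cmod (phase \<theta> a - 1))\<^sup>2 \<le> num_verts * energy \<theta> h"
proof (rule obtain_zero_path[OF head_in_verts[OF a(1)] tail_in_verts[OF a(1)]])
  fix P
  assume P: "P \<subseteq> arcs Q" "\<And>a. a \<in> P \<Longrightarrow> \<tau> a = 0" "\<And>a. a \<in> P \<Longrightarrow> flip a \<notin> P"
      "card P < card (verts Q)"
    and h: "\<And>\<theta> h. cmod (h (head Q a) - h (tail Q a)) \<le> (\<Sum>a\<in>P. defect \<theta> h a)"
  have fin: "finite P" by (rule finite_subset[OF P(1) finite_arcs])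
  let ?C = "insert a P"
  have nP: "a \<notin> P" using a P by auto
  have "(\<Sum>b\<in>?C. defect \<theta> h b)\<^sup>2 \<le> num_verts * energy \<theta> h"
  proof (rule sum_defect_le)
    show "?C \<subseteq> arcs Q" using a P by simp
    show "card ?C \<le> card (verts Q)" using P(4) fin nP by simp
    fix b assume b: "b \<in> ?C"
    have "flip a \<noteq> a" using index_flip[OF a(1)] a(2) by (auto simp: vec_eq_iff)
    moreover have "flip a \<notin> P" using P(2)[of "flip a"] a by auto
    moreover have "flip b \<noteq> a" if "b \<in> P" using index_flip[of b] P that a(2) by auto
    ultimately show "flip b \<notin> ?C" using b P(3) by auto
  qed
  moreover have "cmod (h (tail Q a)) * cmod (phase \<theta> a - 1) \<le> (\<Sum>b\<in>?C. defect \<theta> h b)"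
  proof -
    have "cmod (h (tail Q a)) * cmod (phase \<theta> a - 1)
        = cmod ((h (tail Q a) - phase \<theta> a * h (head Q a)) + phase \<theta> a * (h (head Q a) - h (tail Q a)))"
      by (simp add: algebra_simps norm_minus_commute flip: norm_mult)
    also have "\<dots> \<le> defect \<theta> h a + cmod (h (head Q a) - h (tail Q a))"
      by (rule order_trans[OF norm_triangle_ineq]) (simp add: defect_def norm_mult)
    also have "\<dots> \<le> defect \<theta> h a + (\<Sum>b\<in>P. defect \<theta> h b)" using h by simp
    finally show ?thesis using fin nP by simp
  qed
  ultimately show ?thesis by (meson order_trans power_mono mult_nonneg_nonneg norm_ge_zero)
qed

lemma first_band_ge:
  assumes a: "a \<in> arcs Q" "\<tau> a \<noteq> 0"
    and small: "sqrt (num_verts * first_band Q \<tau> \<theta>) \<le> 1 / sqrt total_degree"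
  shows "(1 / sqrt total_degree - sqrt (num_verts * first_band Q \<tau> \<theta>))\<^sup>2 * (cmod (phase \<theta> a - 1))\<^sup>2
    \<le> num_verts * first_band Q \<tau> \<theta>"
proof (rule first_band_attained[of \<theta>])
  fix h assume h: "(\<Sum>v\<in>verts Q. deg v * (cmod (h v))\<^sup>2) = 1" "energy \<theta> h = first_band Q \<tau> \<theta>"
  have "(1 / sqrt total_degree - sqrt (num_verts * first_band Q \<tau> \<theta>))\<^sup>2 \<le> (cmod (h (tail Q a)))\<^sup>2"
    using small amplitude_ge[OF h(1) tail_in_verts[OF a(1)], of \<theta>] by (intro power_mono) (simp_all add: h(2))
  then show ?thesis
    using cycle_bound[OF a, of h \<theta>] unfolding h(2) power_mult_distrib
    by (meson mult_right_mono order_trans zero_le_power2)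
qed

lemma norm_phase_minus_1: "cmod (phase \<theta> a - 1) = 2 * \<bar>sin ((\<tau> a \<bullet> \<theta>) / 2)\<bar>"
  unfolding phase_def by (rule dist_exp_i_1)

text \<open>
  Constant functions are the eigenfunctions at \<open>\<theta> = 0\<close>; here they serve as trial functions.
\<close>

lemma first_band_upper: "total_degree * first_band Q \<tau> \<theta> \<le> (\<Sum>a\<in>arcs Q. (\<tau> a \<bullet> \<theta>)\<^sup>2) / 2"
proof -
  have "(defect \<theta> (\<lambda>_. 1) a)\<^sup>2 \<le> (\<tau> a \<bullet> \<theta>)\<^sup>2" for a
  proof -
    have "defect \<theta> (\<lambda>_. 1) a = 2 * \<bar>sin ((\<tau> a \<bullet> \<theta>) / 2)\<bar>"
      by (simp add: defect_def norm_minus_commute[of 1] norm_phase_minus_1)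
    also have "\<dots> \<le> \<bar>\<tau> a \<bullet> \<theta>\<bar>" using abs_sin_x_le_abs_x[of "(\<tau> a \<bullet> \<theta>) / 2"] by simp
    finally have "\<bar>defect \<theta> (\<lambda>_. 1) a\<bar> \<le> \<bar>\<tau> a \<bullet> \<theta>\<bar>" by simp
    then show ?thesis by (simp only: abs_le_square_iff)
  qed
  then have "energy \<theta> (\<lambda>_. 1) \<le> (\<Sum>a\<in>arcs Q. (\<tau> a \<bullet> \<theta>)\<^sup>2) / 2"
    by (simp add: energy_def sum_mono divide_right_mono)
  then show ?thesis using first_band_le[of \<theta> "\<lambda>_. 1"]
    by (simp add: total_degree_def mult.commute)
qed

context
  fixes \<mu> :: "real^'d \<Rightarrow> real" and \<omega> :: "real^'d"
  assumes eff: "effective_form (first_band Q \<tau>) \<mu>" and unit: "norm \<omega> = 1"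
begin

lemma effective_form_ge:
  assumes a: "a \<in> arcs Q" "\<tau> a \<noteq> 0"
  shows "(\<tau> a \<bullet> \<omega>)\<^sup>2 / (total_degree * num_verts) \<le> \<mu> \<omega>"
proof -
  let ?l = "\<lambda>\<epsilon>. first_band Q \<tau> (\<epsilon> *\<^sub>R \<omega>)"
  have lim: "((\<lambda>\<epsilon>. ?l \<epsilon> / \<epsilon>\<^sup>2) \<longlongrightarrow> \<mu> \<omega>) (at_right 0)"
    by (rule effective_form_tendsto[OF eff unit])
  have pos: "\<forall>\<^sub>F \<epsilon> in at_right 0. (\<epsilon>::real) > 0" by (simp add: eventually_at_filter)
  \<comment> \<open>The band itself tends to zero, hence so does the correction to the amplitude.\<close>
  have "((\<lambda>\<epsilon>::real. \<epsilon>\<^sup>2) \<longlongrightarrow> 0) (at_right 0)"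
    by (rule tendsto_eq_intros refl | simp)+
  from tendsto_mult[OF lim this]
  have "((\<lambda>\<epsilon>. ?l \<epsilon> / \<epsilon>\<^sup>2 * \<epsilon>\<^sup>2) \<longlongrightarrow> 0) (at_right 0)" by simp
  then have "(?l \<longlongrightarrow> 0) (at_right 0)"
    by (rule Lim_transform_eventually) (use pos in \<open>eventually_elim, simp\<close>)
  then have root: "((\<lambda>\<epsilon>. sqrt (num_verts * ?l \<epsilon>)) \<longlongrightarrow> 0) (at_right 0)"
    by (auto intro!: tendsto_eq_intros)
  have small: "\<forall>\<^sub>F \<epsilon> in at_right 0. sqrt (num_verts * ?l \<epsilon>) < 1 / sqrt total_degree"
    using total_degree_pos by (intro order_tendstoD(2)[OF root]) simp
  have "(1 / sqrt total_degree - 0)\<^sup>2 * (\<tau> a \<bullet> \<omega>)\<^sup>2 \<le> num_verts * \<mu> \<omega>"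
  proof (rule tendsto_le)
    show "((\<lambda>\<epsilon>. num_verts * (?l \<epsilon> / \<epsilon>\<^sup>2)) \<longlongrightarrow> num_verts * \<mu> \<omega>) (at_right 0)"
      by (intro tendsto_intros lim)
    show "((\<lambda>\<epsilon>. (1 / sqrt total_degree - sqrt (num_verts * ?l \<epsilon>))\<^sup>2
        * (2 * sin (\<epsilon> * (\<tau> a \<bullet> \<omega>) / 2) / \<epsilon>)\<^sup>2)
        \<longlongrightarrow> (1 / sqrt total_degree - 0)\<^sup>2 * (\<tau> a \<bullet> \<omega>)\<^sup>2) (at_right 0)"
      by (intro tendsto_intros root sin_quotient_tendsto)
    show "\<forall>\<^sub>F \<epsilon> in at_right 0. (1 / sqrt total_degree - sqrt (num_verts * ?l \<epsilon>))\<^sup>2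
        * (2 * sin (\<epsilon> * (\<tau> a \<bullet> \<omega>) / 2) / \<epsilon>)\<^sup>2 \<le> num_verts * (?l \<epsilon> / \<epsilon>\<^sup>2)"
      using small pos
    proof eventually_elim
      case (elim \<epsilon>)
      have "(2 * sin (\<epsilon> * (\<tau> a \<bullet> \<omega>) / 2) / \<epsilon>)\<^sup>2 = (cmod (phase (\<epsilon> *\<^sub>R \<omega>) a - 1))\<^sup>2 / \<epsilon>\<^sup>2"
        by (simp add: norm_phase_minus_1 power_divide power_mult_distrib)
      then show ?case
        using divide_right_mono[OF first_band_ge[OF a less_imp_le[OF elim(1)]], of "\<epsilon>\<^sup>2"] by simp
    qed
  qed simp
  then show ?thesis using total_degree_pos num_verts_pos
    by (simp add: power_divide field_simps)
qed

lemma effective_form_le: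
  assumes E: "edge_orientation Q flip E"
  shows "\<mu> \<omega> \<le> (\<Sum>b\<in>bridges \<tau> E. (\<tau> b \<bullet> \<omega>)\<^sup>2) / total_degree"
proof -
  have E_arcs: "E \<subseteq> arcs Q" using E by (simp add: edge_orientation_def)
  have "(\<Sum>a\<in>arcs Q. (\<tau> a \<bullet> \<omega>)\<^sup>2) = 2 * (\<Sum>a\<in>E. (\<tau> a \<bullet> \<omega>)\<^sup>2)"
    by (rule sum_edge_orientation[OF E finite_arcs]) simp_all
  also have "(\<Sum>a\<in>E. (\<tau> a \<bullet> \<omega>)\<^sup>2) = (\<Sum>b\<in>bridges \<tau> E. (\<tau> b \<bullet> \<omega>)\<^sup>2)"
    by (rule sum.mono_neutral_right) (use finite_subset[OF E_arcs] in \<open>auto simp: bridges_def\<close>)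
  finally have sum: "(\<Sum>a\<in>arcs Q. (\<tau> a \<bullet> \<omega>)\<^sup>2) / 2 = (\<Sum>b\<in>bridges \<tau> E. (\<tau> b \<bullet> \<omega>)\<^sup>2)" by simp
  show ?thesis
  proof (rule tendsto_upperbound[OF effective_form_tendsto[OF eff unit]])
    have pos: "\<forall>\<^sub>F \<epsilon> in at_right 0. (\<epsilon>::real) > 0" by (simp add: eventually_at_filter)
    show "\<forall>\<^sub>F \<epsilon> in at_right 0. first_band Q \<tau> (\<epsilon> *\<^sub>R \<omega>) / \<epsilon>\<^sup>2
        \<le> (\<Sum>b\<in>bridges \<tau> E. (\<tau> b \<bullet> \<omega>)\<^sup>2) / total_degree"
      using pos
    proof eventually_elim
      case (elim \<epsilon>)
      have "(\<Sum>a\<in>arcs Q. (\<tau> a \<bullet> (\<epsilon> *\<^sub>R \<omega>))\<^sup>2) = \<epsilon>\<^sup>2 * (\<Sum>a\<in>arcs Q. (\<tau> a \<bullet> \<omega>)\<^sup>2)"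
        by (simp add: power_mult_distrib sum_distrib_left)
      then have "total_degree * first_band Q \<tau> (\<epsilon> *\<^sub>R \<omega>) \<le> \<epsilon>\<^sup>2 * (\<Sum>b\<in>bridges \<tau> E. (\<tau> b \<bullet> \<omega>)\<^sup>2)"
        using first_band_upper[of "\<epsilon> *\<^sub>R \<omega>"] sum by simp
      with elim total_degree_pos show ?case by (simp add: field_simps)
    qed
  qed simp
qed

end
end

section \<open>The quotient of a periodic graph\<close>

context periodic_graph
begin

abbreviation
  "quot \<equiv> quotient_graph G vact aact"

lemma vact_neg: "v \<in> verts G \<Longrightarrow> vact (- m) (vact m v) = v"
  using vact_add[of v "- m" m] vact_zero by simp

lemma vact_in_orbit: "v \<in> verts G \<Longrightarrow> v \<in> orbit vact v"
  using vact_zero[of v] unfolding orbit_def by (metis rangeI)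

lemma aact_in_orbit: "a \<in> arcs G \<Longrightarrow> a \<in> orbit aact a"
  using aact_zero[of a] unfolding orbit_def by (metis rangeI)

lemma tail_orbit: "a \<in> arcs G \<Longrightarrow> tail G ` orbit aact a = orbit vact (tail G a)"
  by (simp add: orbit_def image_image tail_aact)

lemma head_orbit: "a \<in> arcs G \<Longrightarrow> head G ` orbit aact a = orbit vact (head G a)"
  by (simp add: orbit_def image_image head_aact)

lemma arev_orbit: "a \<in> arcs G \<Longrightarrow> arev ` orbit aact a = orbit aact (arev a)"
  by (simp add: orbit_def image_image arev_aact)

lemma quotient_simps [simp]:
  "verts quot = orbit vact ` verts G" "arcs quot = orbit aact ` arcs G"
  "tail quot = image (tail G)" "head quot = image (head G)"
  by (simp_all add: quotient_graph_def)

context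
  fixes V0
  assumes V0: "fundamental_vertex_set G vact V0"
begin

lemma V0_verts: "v \<in> V0 \<Longrightarrow> v \<in> verts G"
  using V0 by (auto simp: fundamental_vertex_set_def)

lemma V0_unique: "u \<in> V0 \<Longrightarrow> v \<in> V0 \<Longrightarrow> v = vact m u \<Longrightarrow> u = v"
  using V0 by (auto simp: fundamental_vertex_set_def)

text \<open>
  Inequivalent vertices have distinct orbits, so a fundamental set of the right cardinality meets all
  of them.
\<close>

lemma orbits_V0: "orbit vact ` V0 = orbit vact ` verts G"
proof (rule card_subset_eq)
  show "finite (orbit vact ` verts G)" using finite_quotient_verts by simp
  show "orbit vact ` V0 \<subseteq> orbit vact ` verts G" using V0_verts by blast
  have "inj_on (orbit vact) V0"
  proof (rule inj_onI)
    fix u v assume uv: "u \<in> V0" "v \<in> V0" "orbit vact u = orbit vact v"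
    then have "v \<in> orbit vact u" using vact_in_orbit[OF V0_verts] by metis
    then show "u = v" using V0_unique[OF uv(1,2)] by (auto simp: orbit_def)
  qed
  then show "card (orbit vact ` V0) = card (orbit vact ` verts G)"
    using V0 by (simp add: card_image fundamental_vertex_set_def)
qed

lemma obtain_representative:
  assumes "v \<in> verts G"
  obtains v0 m where "v0 \<in> V0" "v = vact m v0"
proof -
  obtain v0 where "v0 \<in> V0" "orbit vact v = orbit vact v0"
    using orbits_V0 assms by (metis imageE imageI)
  then have "v \<in> orbit vact v0" using vact_in_orbit[OF assms] by simp
  then show ?thesis using that \<open>v0 \<in> V0\<close> by (auto simp: orbit_def)
qed

lemma int_part_vact_V0:
  assumes "v0 \<in> V0"
  shows "int_part vact V0 (vact m v0) = m"
  unfolding int_part_def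
proof (rule the_equality)
  show "\<exists>w\<in>V0. vact m v0 = vact m w" using assms by blast
  fix n assume "\<exists>w\<in>V0. vact m v0 = vact n w"
  then obtain w where w: "w \<in> V0" "vact m v0 = vact n w" by blast
  have eq: "w = vact (m - n) v0"
    using vact_neg[OF V0_verts[OF w(1)], of n] w(2) vact_add[OF V0_verts[OF assms], of "- n" m] by simp
  then have "v0 = w" using V0_unique[OF assms w(1)] by blast
  then show "n = m" using vact_free[OF V0_verts[OF assms], of "m - n"] eq by simp
qed

lemma int_part_vact: "v \<in> verts G \<Longrightarrow> int_part vact V0 (vact n v) = n + int_part vact V0 v"
  by (metis obtain_representative int_part_vact_V0 vact_add V0_verts)

lemma int_part_V0: "v0 \<in> V0 \<Longrightarrow> int_part vact V0 v0 = 0"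
  using int_part_vact_V0[of v0 0] vact_zero V0_verts by simp

lemma quotient_index_orbit:
  assumes "a \<in> arcs G"
  shows "quotient_index G vact V0 (orbit aact a) = real_vec (arc_index G vact V0 a)"
proof -
  have "arc_index G vact V0 (aact n a) = arc_index G vact V0 a" for n
    using assms by (simp add: arc_index_def tail_aact head_aact int_part_vact)
  then have "arc_index G vact V0 ` orbit aact a = {arc_index G vact V0 a}"
    using aact_in_orbit[OF assms] by (auto simp: orbit_def)
  then show ?thesis by (simp add: quotient_index_def)
qed

end

lemma wf_digraph_quotient: "wf_digraph quot"
  by unfold_locales (auto simp: tail_orbit head_orbit)

text \<open>
  Both ends of an edge of \<open>T\<close> are their own representatives, so the edge has zero index; and the
  vertices of \<open>T\<close> represent all vertices of the quotient. A walk in \<open>T\<close> thus projects to a walk of zero index.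
\<close>

lemma zero_index_quotient_connected:
  assumes tree: "is_subtree T G arev" and V0: "fundamental_vertex_set G vact (verts T)"
  shows "strongly_connected
    (quot\<lparr>arcs := {A \<in> arcs quot. quotient_index G vact (verts T) A = 0}\<rparr>)"
    (is "strongly_connected ?Z")
proof -
  interpret Q: wf_digraph quot by (rule wf_digraph_quotient)
  interpret Z: wf_digraph ?Z
    using Q.wellformed by unfold_locales auto
  have sub: "subgraph T G" and rev: "\<And>a. a \<in> arcs T \<Longrightarrow> arev a \<in> arcs T"
    and conn: "strongly_connected (mk_symmetric T)"
    using tree by (auto simp: is_subtree_def connected_def)
  have T: "tail T = tail G" "head T = head G" "arcs T \<subseteq> arcs G"
    using sub by (auto simp: subgraph_def compatible_def)
  interpret T: wf_digraph T using sub by (simp add: subgraph_def)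
  have "symmetric T"
    unfolding symmetric_conv T
  proof (intro ballI)
    fix a assume "a \<in> arcs T"
    then show "\<exists>b\<in>arcs T. tail G a = head G b \<and> head G a = tail G b"
      using rev T(3) by (intro bexI[of _ "arev a"]) auto
  qed
  then have reach: "u \<rightarrow>\<^sup>*\<^bsub>T\<^esub> v" if "u \<in> verts T" "v \<in> verts T" for u v
    using conn that T.reachable_mk_symmetric_eq by (auto simp: strongly_connected_def)
  have lift: "orbit vact u \<rightarrow>\<^sup>*\<^bsub>?Z\<^esub> orbit vact v" if "u \<rightarrow>\<^sup>*\<^bsub>T\<^esub> v" for u v
    using that
  proof (induction rule: T.reachable_induct)
    case base
    then show ?case using V0_verts[OF V0] by (intro Z.reachable_refl) simp
  next
    case (step x y)
    then obtain a where a: "a \<in> arcs T" "tail G a = x" "head G a = y"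
      by (auto simp: arcs_ends_conv T)
    have aG: "a \<in> arcs G" and xy: "x \<in> verts T" "y \<in> verts T"
      using a T T.wellformed[of a] by auto
    have "arc_index G vact (verts T) a = 0"
      using xy by (simp add: arc_index_def a int_part_V0[OF V0])
    then have "orbit aact a \<in> arcs ?Z"
      using aG quotient_index_orbit[OF V0 aG] by (simp add: real_vec_def vec_eq_iff)
    moreover have "arc_to_ends ?Z (orbit aact a) = (orbit vact x, orbit vact y)"
      using a aG by (simp add: arc_to_ends_def tail_orbit head_orbit)
    ultimately have "orbit vact x \<rightarrow>\<^bsub>?Z\<^esub> orbit vact y" by (intro Z.dominatesI)
    with step.IH show ?case by (rule Z.reachable_adj_trans)
  qed
  have "verts quot = orbit vact ` verts T" using orbits_V0[OF V0] by simp
  moreover have "verts T \<noteq> {}" using conn by (auto simp: strongly_connected_def)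
  ultimately show ?thesis using lift reach by (auto simp: strongly_connected_def)
qed

lemma indexed_graph_quotient:
  assumes tree: "is_subtree T G arev" and V0: "fundamental_vertex_set G vact (verts T)"
    and "A \<in> arcs quot" "quotient_index G vact (verts T) A \<noteq> 0"
  shows "indexed_graph quot (image arev) (quotient_index G vact (verts T))"
proof -
  interpret Q: wf_digraph quot by (rule wf_digraph_quotient)
  show ?thesis
  proof
    show "finite (verts quot)" "finite (arcs quot)"
      by (rule finite_quotient_verts finite_quotient_arcs)+
    show "strongly_connected
        (quot\<lparr>arcs := {A \<in> arcs quot. quotient_index G vact (verts T) A = 0}\<rparr>)"
      by (rule zero_index_quotient_connected[OF tree V0])
    show "\<exists>A\<in>arcs quot. quotient_index G vact (verts T) A \<noteq> 0" using assms by blast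
    fix A assume "A \<in> arcs quot"
    then obtain a where a: "a \<in> arcs G" "A = orbit aact a" by auto
    have rev: "arev ` A = orbit aact (arev a)" using a by (simp add: arev_orbit)
    then show "arev ` A \<in> arcs quot" using a by simp
    show "arev ` arev ` A = A" by (simp add: image_image)
    show "tail quot (arev ` A) = head quot A"
      unfolding rev using a by (simp add: tail_orbit head_orbit)
    show "quotient_index G vact (verts T) (arev ` A) = - quotient_index G vact (verts T) A"
      unfolding rev using a
      by (simp add: quotient_index_orbit[OF V0] arc_index_def real_vec_def vec_eq_iff)
  qed
qed

end

section \<open>Real quadratic forms\<close>

text \<open>
  The real or the imaginary part of a complex eigenvector is a real eigenvector, which reduces real symmetric
  matrices to Hermitian ones.
\<close>

lemma eigenvalue_on_complexify:
  fixes A :: "'i \<Rightarrow> 'i \<Rightarrow> real"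
  shows "eigenvalue_on I (\<lambda>i j. complex_of_real (A i j)) (of_real l) \<longleftrightarrow> eigenvalue_on I A l"
proof
  assume "eigenvalue_on I A l"
  then obtain f where f: "\<exists>u\<in>I. f u \<noteq> 0" "\<forall>u\<in>I. (\<Sum>v\<in>I. A u v * f v) = l * f u"
    by (auto simp: eigenvalue_on_def)
  then show "eigenvalue_on I (\<lambda>i j. complex_of_real (A i j)) (of_real l)"
    unfolding eigenvalue_on_def
    by (intro exI[of _ "\<lambda>u. of_real (f u)"]) (auto simp flip: of_real_mult of_real_sum)
next
  assume "eigenvalue_on I (\<lambda>i j. complex_of_real (A i j)) (of_real l)"
  then obtain f :: "'i \<Rightarrow> complex" and w where w: "w \<in> I" "f w \<noteq> 0"
    and f: "\<And>u. u \<in> I \<Longrightarrow> (\<Sum>v\<in>I. of_real (A u v) * f v) = of_real l * f u"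
    by (auto simp: eigenvalue_on_def)
  have re: "(\<Sum>v\<in>I. A u v * Re (f v)) = l * Re (f u)"
    and im: "(\<Sum>v\<in>I. A u v * Im (f v)) = l * Im (f u)" if "u \<in> I" for u
    using arg_cong[OF f[OF that], of Re] arg_cong[OF f[OF that], of Im] by simp_all
  from w(2) consider "Re (f w) \<noteq> 0" | "Im (f w) \<noteq> 0" by (auto simp: complex_eq_iff)
  then show "eigenvalue_on I A l"
  proof cases
    case 1
    then show ?thesis unfolding eigenvalue_on_def using w re by (intro exI[of _ "\<lambda>u. Re (f u)"]) auto
  next
    case 2
    then show ?thesis unfolding eigenvalue_on_def using w im by (intro exI[of _ "\<lambda>u. Im (f u)"]) auto
  qed
qed

lemma
  fixes A :: "real^'n^'n"
  assumes A: "transpose A = A"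
  shows smallest_eigenvalue_le: "smallest_eigenvalue A * (norm x)\<^sup>2 \<le> (A *v x) \<bullet> x"
    and smallest_eigenvalue_eigenvector: "\<exists>x. x \<noteq> 0 \<and> A *v x = smallest_eigenvalue A *\<^sub>R x"
proof -
  let ?K = "\<lambda>i j. complex_of_real (A $ i $ j)"
  have herm: "hermitian_on UNIV ?K"
    unfolding hermitian_on_def
  proof (intro ballI)
    fix i j
    have "A $ j $ i = transpose A $ i $ j" by (simp add: transpose_def)
    then show "complex_of_real (A $ j $ i) = cnj (complex_of_real (A $ i $ j))"
      unfolding A by (simp only: complex_cnj_complex_of_real)
  qed
  note min = hermitian_min_eigenvalue[OF finite UNIV_not_empty herm, unfolded eigenvalue_on_complexify]
  have "cinner_on UNIV (\<lambda>i. of_real (x $ i)) (mat_app UNIV ?K (\<lambda>i. of_real (x $ i)))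
      = complex_of_real ((A *v x) \<bullet> x)"
    by (simp add: cinner_on_def mat_app_def inner_vec_def matrix_vector_mult_def mult.commute
        flip: of_real_mult of_real_sum)
  then show "smallest_eigenvalue A * (norm x)\<^sup>2 \<le> (A *v x) \<bullet> x"
    using min(3)[of "\<lambda>i. of_real (x $ i)"]
    by (simp add: smallest_eigenvalue_def norm_vec_def L2_set_def sum_nonneg)
  have "eigenvalue_on UNIV (\<lambda>i j. A $ i $ j) (smallest_eigenvalue A)"
    using Min_in[OF min(1,2)] by (simp add: smallest_eigenvalue_def)
  then obtain f where f: "\<exists>u. f u \<noteq> 0" "\<forall>u. (\<Sum>v\<in>UNIV. A $ u $ v * f v) = smallest_eigenvalue A * f u"
    by (auto simp: eigenvalue_on_def)
  then show "\<exists>x. x \<noteq> 0 \<and> A *v x = smallest_eigenvalue A *\<^sub>R x"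
    by (intro exI[of _ "\<chi> i. f i"]) (auto simp: vec_eq_iff matrix_vector_mult_def)
qed

lemma gram_form: "(transpose T ** T *v x) \<bullet> x = (\<Sum>i\<in>UNIV. (T $ i \<bullet> x)\<^sup>2)"
  for T :: "real^'n^'m"
proof -
  have "(transpose T ** T *v x) \<bullet> x = ((T *v x) v* T) \<bullet> x"
    by (simp only: transpose_matrix_vector flip: matrix_vector_mul_assoc)
  also have "\<dots> = (T *v x) \<bullet> (T *v x)" by (rule dot_lmul_matrix)
  also have "\<dots> = (\<Sum>i\<in>UNIV. (T $ i \<bullet> x)\<^sup>2)"
    by (simp add: inner_vec_def[of "T *v x" "T *v x"] matrix_vector_mul_component power2_eq_square)
  finally show ?thesis .
qed

text \<open>
  A vector in the kernel of the Gram matrix is orthogonal to all rows of \<open>T\<close>, and these span the space.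
\<close>

lemma smallest_eigenvalue_gram_pos:
  fixes T :: "real^'n^'n"
  assumes "inj (\<lambda>i. T $ i)" "independent (range (\<lambda>i. T $ i))"
  shows "0 < smallest_eigenvalue (transpose T ** T)"
proof -
  let ?A = "transpose T ** T"
  have "transpose ?A = ?A" by (simp add: matrix_transpose_mul)
  then obtain x where x: "x \<noteq> 0" "?A *v x = smallest_eigenvalue ?A *\<^sub>R x"
    using smallest_eigenvalue_eigenvector by blast
  have "(\<Sum>i\<in>UNIV. (T $ i \<bullet> x)\<^sup>2) \<noteq> 0"
  proof
    assume "(\<Sum>i\<in>UNIV. (T $ i \<bullet> x)\<^sup>2) = 0"
    then have "T $ i \<bullet> x = 0" for i by (simp add: sum_nonneg_eq_0_iff)
    then have orth: "orthogonal x y" if "y \<in> range (\<lambda>i. T $ i)" for y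
      using that by (auto simp: orthogonal_def inner_commute)
    have "dim (UNIV :: (real^'n) set) \<le> card (range (\<lambda>i. T $ i))"
      using card_image[OF assms(1)] by simp
    then have "UNIV \<subseteq> span (range (\<lambda>i. T $ i))"
      by (rule card_ge_dim_independent[OF subset_UNIV assms(2)])
    then have "x \<in> span (range (\<lambda>i. T $ i))" by blast
    then have "orthogonal x x" by (rule orthogonal_to_span) (rule orth)
    then show False using x(1) by (simp add: orthogonal_def)
  qed
  moreover have "0 \<le> (\<Sum>i\<in>UNIV. (T $ i \<bullet> x)\<^sup>2)" by (simp add: sum_nonneg)
  ultimately have "0 < (\<Sum>i\<in>UNIV. (T $ i \<bullet> x)\<^sup>2)" by linarith
  then have "0 < smallest_eigenvalue ?A * (x \<bullet> x)"
    unfolding gram_form[of T x, symmetric] x(2) by (simp only: inner_scaleR_left)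
  moreover have "0 < x \<bullet> x" using x(1) by simp
  ultimately show ?thesis by (rule zero_less_mult_pos2)
qed

lemma trace_quadratic_form: "trace M = (\<Sum>i\<in>UNIV. (M *v axis i 1) \<bullet> axis i 1)"
  for M :: "real^'n^'n"
  by (simp add: trace_def inner_axis matrix_vector_mul_component)

lemma invertible_if_form_ge:
  fixes M :: "real^'n^'n"
  assumes "0 < c" "\<And>x. c * (norm x)\<^sup>2 \<le> (M *v x) \<bullet> x"
  shows "invertible M"
proof -
  have "x = 0" if "M *v x = 0" for x
  proof -
    have "c * (norm x)\<^sup>2 \<le> 0" using assms(2)[of x] unfolding that by simp
    then show ?thesis using assms(1) by (simp add: mult_le_0_iff)
  qed
  then show ?thesis
    by (simp add: invertible_left_inverse matrix_left_invertible_ker)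
qed

text \<open>
  If \<open>M\<^sup>-\<^sup>1 x = l x\<close> then \<open>l \<langle>M x, x\<rangle> = \<parallel>x\<parallel>\<^sup>2\<close>, so \<open>1/l\<close> is a value of the Rayleigh quotient of \<open>M\<close>.
\<close>

lemma eigenvalue_matrix_inv_bounds:
  fixes M :: "real^'n^'n"
  assumes c: "0 < c" and lower: "\<And>x. c * (norm x)\<^sup>2 \<le> (M *v x) \<bullet> x"
    and upper: "\<And>x. (M *v x) \<bullet> x \<le> C * (norm x)\<^sup>2"
    and l: "det (mat l - matrix_inv M) = 0"
  shows "1 / C \<le> l" "l \<le> 1 / c"
proof -
  have inv: "invertible M" by (rule invertible_if_form_ge[OF c lower])
  from l have "\<not> invertible (mat l - matrix_inv M)" by (simp add: invertible_det_nz)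
  then obtain x where x: "x \<noteq> 0" "(mat l - matrix_inv M) *v x = 0"
    by (auto simp: invertible_left_inverse matrix_left_invertible_ker)
  have "mat l *v x = l *\<^sub>R x"
  proof -
    have "mat l = l *\<^sub>R (mat 1 :: real^'n^'n)" by (simp add: mat_def vec_eq_iff)
    then show ?thesis by (metis scaleR_matrix_vector_assoc matrix_vector_mul_lid)
  qed
  moreover have "mat l *v x - matrix_inv M *v x = 0"
    using x(2) by (simp only: matrix_vector_mult_diff_rdistrib)
  ultimately have inv_x: "matrix_inv M *v x = l *\<^sub>R x" by simp
  have "M ** matrix_inv M = mat 1"
    using inv unfolding invertible_def matrix_inv_def by (rule someI2_ex) blast
  then have "x = M *v (matrix_inv M *v x)"
    by (simp only: matrix_vector_mul_assoc matrix_vector_mul_lid)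
  also have "\<dots> = l *\<^sub>R (M *v x)" unfolding inv_x by (rule matrix_vector_mult_scaleR)
  finally have "x \<bullet> x = l * ((M *v x) \<bullet> x)" by (metis inner_scaleR_left)
  then have lq: "l * ((M *v x) \<bullet> x) = (norm x)\<^sup>2" by (simp only: power2_norm_eq_inner)
  have n: "0 < (norm x)\<^sup>2" using x(1) by simp
  have q: "0 < (M *v x) \<bullet> x" using lower[of x] mult_pos_pos[OF c n] by linarith
  have "0 < l * ((M *v x) \<bullet> x)" unfolding lq by (rule n)
  then have l: "0 < l" using q by (rule zero_less_mult_pos2)
  have C: "0 < C" 
  proof -
    have "0 < C * (norm x)\<^sup>2" using upper[of x] q by linarith
    then show ?thesis using n by (rule zero_less_mult_pos2)
  qed
  have "l * c * (norm x)\<^sup>2 \<le> 1 * (norm x)\<^sup>2"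
    using mult_left_mono[OF lower[of x], of l] l unfolding lq by (simp add: mult.assoc)
  then have "l * c \<le> 1" by (rule mult_right_le_imp_le[OF _ n])
  then show "l \<le> 1 / c" using c by (simp add: pos_le_divide_eq)
  have "1 * (norm x)\<^sup>2 \<le> l * C * (norm x)\<^sup>2"
    using mult_left_mono[OF upper[of x], of l] l unfolding lq by (simp add: mult.assoc)
  then have "1 \<le> l * C" by (rule mult_right_le_imp_le[OF _ n])
  then show "1 / C \<le> l" using C by (simp add: pos_divide_le_eq)
qed

section \<open>Trace and effective masses\<close>

theorem corollary1p3:
  fixes G T :: "('v,'a) pre_digraph"
    and arev :: "'a \<Rightarrow> 'a"
    and vact :: "int^'d::finite \<Rightarrow> 'v \<Rightarrow> 'v"
    and aact :: "int^'d \<Rightarrow> 'a \<Rightarrow> 'a"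
    and E :: "'a set set"
    and e0 :: "'a set"
    and e :: "'d \<Rightarrow> 'a set"
    and \<mu> :: "real^'d \<Rightarrow> real"
    and M :: "real^'d^'d"
  defines "Q \<equiv> quotient_graph G vact aact"
    and "\<tau> \<equiv> quotient_index G vact (verts T)"
  defines "B \<equiv> bridges \<tau> E"
    and "T0 \<equiv> (\<chi> i. \<tau> (e i)) :: real^'d^'d"
  defines "\<Lambda>0 \<equiv> smallest_eigenvalue (transpose T0 ** T0)"
    and "\<nu> \<equiv> real (card (verts Q))"
    and "\<kappa> \<equiv> (\<Sum>v\<in>verts Q. real (out_degree Q v))"
  defines "C0 \<equiv> 1 / (\<kappa> * \<nu>) * (norm (\<tau> e0))^2"
    and "C1 \<equiv> 1 / \<kappa> * (\<Sum>b\<in>B. (norm (\<tau> b))^2)"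
  assumes periodic: "periodic_graph G arev vact aact"
    and tree: "is_subtree T G arev"
    and fundamental: "fundamental_vertex_set G vact (verts T)"
    and orientation: "edge_orientation Q (image arev) E"
    and e0_bridge: "e0 \<in> B"
    and e_bridges: "\<And>i. e i \<in> B"
    and e_independent: "inj (\<lambda>i. \<tau> (e i))" "independent (range (\<lambda>i. \<tau> (e i)))"
    and effective: "effective_form (first_band Q \<tau>) \<mu>"
    and M_symmetric: "transpose M = M"
    and M_form: "\<And>\<omega>. norm \<omega> = 1 \<Longrightarrow> \<mu> \<omega> = (M *v \<omega>) \<bullet> \<omega>"
  shows "C0 \<le> trace M \<and> trace M \<le> C1 \<and>
    invertible M \<and>
    (\<forall>m. decreasing_eigenvalues (matrix_inv M) m \<longrightarrow>
       \<kappa> * \<nu> * real CARD('d) / \<Lambda>0 \<ge> m 1 \<and>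
       (\<forall>i\<in>{1..<CARD('d)}. m i \<ge> m (Suc i)) \<and>
       m (CARD('d)) \<ge> 1 / C1)"
proof -
  interpret P: periodic_graph G arev vact aact by (rule periodic)
  have bridge: "b \<in> arcs Q" "\<tau> b \<noteq> 0" if "b \<in> B" for b
    using that orientation by (auto simp: B_def bridges_def edge_orientation_def)
  interpret I: indexed_graph Q "image arev" \<tau>
    unfolding Q_def \<tau>_def
    by (rule P.indexed_graph_quotient[OF tree fundamental bridge[OF e0_bridge, unfolded Q_def \<tau>_def]])
  have \<kappa>: "I.total_degree = \<kappa>" and \<nu>: "I.num_verts = \<nu>"
    by (simp_all add: I.total_degree_def \<kappa>_def I.num_verts_def \<nu>_def)
  have pos: "0 < \<kappa>" "0 < \<nu>" using I.total_degree_pos I.num_verts_pos by (simp_all add: \<kappa> \<nu>)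
  let ?q = "\<lambda>x. (M *v x) \<bullet> x" and ?S = "\<lambda>x. \<Sum>b\<in>B. (\<tau> b \<bullet> x)\<^sup>2"
  \<comment> \<open>The effective form is known on unit vectors only; the quadratic form of \<open>M\<close> extends it by homogeneity.\<close>
  have homogeneous: "?q x = (norm x)\<^sup>2 * \<mu> (x /\<^sub>R norm x)" if "x \<noteq> 0" for x
  proof -
    define y where "y = x /\<^sub>R norm x"
    have x: "x = norm x *\<^sub>R y" using that by (simp add: y_def)
    have "?q (r *\<^sub>R y) = r\<^sup>2 * ?q y" for r
      by (simp add: matrix_vector_mult_scaleR power2_eq_square)
    then have "?q x = (norm x)\<^sup>2 * ?q y" using x by metis
    moreover have "norm y = 1" using that by (simp add: y_def)
    ultimately show ?thesis using M_form[of y] by (simp add: y_def)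
  qed
  have scale: "(norm x)\<^sup>2 * (y \<bullet> (x /\<^sub>R norm x))\<^sup>2 = (y \<bullet> x)\<^sup>2" if "x \<noteq> 0" for x y :: "real^'d"
    using that by (simp add: power_mult_distrib power_divide field_simps)
  have lower: "(\<tau> b \<bullet> x)\<^sup>2 \<le> \<kappa> * \<nu> * ?q x" if "b \<in> B" for b x
  proof (cases "x = 0")
    case False
    have "(\<tau> b \<bullet> (x /\<^sub>R norm x))\<^sup>2 / (\<kappa> * \<nu>) \<le> \<mu> (x /\<^sub>R norm x)"
      using I.effective_form_ge[OF effective _ bridge[OF that], of "x /\<^sub>R norm x"] False by (simp add: \<kappa> \<nu>)
    then have "(\<tau> b \<bullet> (x /\<^sub>R norm x))\<^sup>2 \<le> \<kappa> * \<nu> * \<mu> (x /\<^sub>R norm x)"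
      using pos by (simp add: pos_divide_le_eq mult.commute)
    from mult_left_mono[OF this, of "(norm x)\<^sup>2"] show ?thesis
      unfolding homogeneous[OF False] scale[OF False] by (simp add: mult.left_commute)
  qed simp
  have upper: "\<kappa> * ?q x \<le> ?S x" for x
  proof (cases "x = 0")
    case False
    have "\<mu> (x /\<^sub>R norm x) \<le> ?S (x /\<^sub>R norm x) / \<kappa>"
      using I.effective_form_le[OF effective _ orientation, of "x /\<^sub>R norm x"] False by (simp add: \<kappa> B_def)
    then have "\<kappa> * \<mu> (x /\<^sub>R norm x) \<le> ?S (x /\<^sub>R norm x)"
      using pos by (simp add: pos_le_divide_eq mult.commute)
    from mult_left_mono[OF this, of "(norm x)\<^sup>2"] show ?thesis
      unfolding homogeneous[OF False] sum_distrib_left scale[OF False] by (simp add: mult.left_commute)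
  qed simp
  have norm_axis: "(\<Sum>i\<in>UNIV. (y \<bullet> axis i 1)\<^sup>2) = (norm y)\<^sup>2" for y :: "real^'d"
    unfolding power2_norm_eq_inner by (simp add: inner_axis inner_vec_def[of y y] power2_eq_square)
  have "(norm (\<tau> e0))\<^sup>2 \<le> \<kappa> * \<nu> * trace M"
    unfolding norm_axis[symmetric] trace_quadratic_form sum_distrib_left by (intro sum_mono lower e0_bridge)
  then have C0: "C0 \<le> trace M" using pos by (simp add: C0_def pos_divide_le_eq mult.commute)
  have "\<kappa> * trace M \<le> (\<Sum>i\<in>UNIV. ?S (axis i 1))"
    unfolding trace_quadratic_form sum_distrib_left by (intro sum_mono upper)
  also have "\<dots> = (\<Sum>b\<in>B. (norm (\<tau> b))\<^sup>2)"
    unfolding norm_axis[symmetric] by (rule sum.swap)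
  finally have C1: "trace M \<le> C1" using pos by (simp add: C1_def pos_le_divide_eq mult.commute)
  define c where "c = \<Lambda>0 / (\<kappa> * \<nu> * real CARD('d))"
  have T0: "T0 $ i = \<tau> (e i)" for i by (simp add: T0_def)
  have "0 < \<Lambda>0"
    unfolding \<Lambda>0_def by (rule smallest_eigenvalue_gram_pos) (use e_independent in \<open>simp_all add: T0\<close>)
  then have c: "0 < c" using pos by (simp add: c_def)
  have ge: "c * (norm x)\<^sup>2 \<le> ?q x" for x
  proof -
    have "\<Lambda>0 * (norm x)\<^sup>2 \<le> (transpose T0 ** T0 *v x) \<bullet> x"
      unfolding \<Lambda>0_def by (rule smallest_eigenvalue_le) (simp add: matrix_transpose_mul)
    also have "\<dots> = (\<Sum>i\<in>UNIV. (\<tau> (e i) \<bullet> x)\<^sup>2)" by (simp add: gram_form T0)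
    also have "\<dots> \<le> (\<Sum>i\<in>(UNIV :: 'd set). \<kappa> * \<nu> * ?q x)" by (intro sum_mono lower e_bridges)
    also have "\<dots> = \<kappa> * \<nu> * real CARD('d) * ?q x" by simp
    finally show ?thesis using pos by (simp add: c_def pos_divide_le_eq mult.commute)
  qed
  have le: "?q x \<le> C1 * (norm x)\<^sup>2" for x
  proof -
    have "\<kappa> * ?q x \<le> (\<Sum>b\<in>B. (norm (\<tau> b))\<^sup>2 * (norm x)\<^sup>2)"
      using upper[of x] by (rule order_trans)
        (intro sum_mono, simp only: power2_norm_eq_inner Cauchy_Schwarz_ineq)
    also have "\<dots> = (\<Sum>b\<in>B. (norm (\<tau> b))\<^sup>2) * (norm x)\<^sup>2" by (rule sum_distrib_right[symmetric])
    finally show ?thesis using pos by (simp add: C1_def pos_le_divide_eq mult.commute)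
  qed
  have "\<kappa> * \<nu> * real CARD('d) / \<Lambda>0 \<ge> m 1 \<and> (\<forall>i\<in>{1..<CARD('d)}. m i \<ge> m (Suc i)) \<and>
      m (CARD('d)) \<ge> 1 / C1" if m: "decreasing_eigenvalues (matrix_inv M) m" for m
  proof -
    have root: "det (mat (m i) - matrix_inv M) = 0" if "i \<in> {1..CARD('d)}" for i
    proof -
      have "(\<Prod>j=1..CARD('d). m i - m j) = 0" using that by (intro prod_zero) auto
      then show ?thesis using m by (simp add: decreasing_eigenvalues_def)
    qed
    have "m 1 \<le> 1 / c"
      by (rule eigenvalue_matrix_inv_bounds(2)[OF c ge le root]) (simp add: Suc_leI)
    moreover have "1 / C1 \<le> m (CARD('d))"
      by (rule eigenvalue_matrix_inv_bounds(1)[OF c ge le root]) (simp add: Suc_leI)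
    ultimately show ?thesis using m by (simp add: c_def decreasing_eigenvalues_def)
  qed
  with C0 C1 invertible_if_form_ge[OF c ge] show ?thesis by blast
qed

end
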